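(* Let $J,\bar J,U,P,\mathcal U,\mathcal P,\bar{\mathbf u}$ and $\mu,\nu>0$ be as in the context, let $\mathcal P_\star\subset\mathcal P$ be the set of minimizers of $\bar J+P$, and assume the step-length assumption and the size-function assumption stated in the context. For $\kappa\in\mathbb N$, $\kappa\ge 1$, consider the bilevel proximal gradient iteration which, from $(\mathbf u^0,p^0)\in\mathcal U\times\mathcal P$, generates for all $\ell\ge 0$ $$\mathbf u^\ell_0=\mathbf u^\ell,\qquad \mathbf u^\ell_{k+1}=\operatorname{prox}_{\mu U}\big[\mathbf u^\ell_k-\mu\nabla_{\mathbf u}J(\mathbf u^\ell_k,p^\ell)\big]\ (k=0,\dots,\kappa-1),\qquad \mathbf u^{\ell+1}=\mathbf u^\ell_\kappa,$$ $$p^{\ell+1}=\operatorname{prox}_{\nu P}\big[p^\ell-\nu\nabla_pJ(\mathbf u^{\ell+1},p^\ell)\big].$$ Then there exists $K\in\mathbb N$ such that, for all $\kappa\ge K$, this iteration, regarded as a discrete-time system with state $(\mathbf u^\ell,p^\ell)\in\mathcal U\times\mathcal P$, is asymptotically stable with respect to the set $$\Omega=\{(\bar{\mathbf u}(p),p)\mid p\in\mathcal P_\star\}$$ (that is, for every $\varepsilon>0$ there is $\delta>0$ such that $\operatorname{dist}_\Omega(\mathbf u^0,p^0)<\delta$ implies $\operatorname{dist}_\Omega(\mathbf u^\ell,p^\ell)<\varepsilon$ for all $\ell\ge0$, and for every initial condition in $\mathcal U\times\mathcal P$ one has $\operatorname{dist}_\Omega(\mathbf u^\ell,p^\ell)\to0$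 as $\ell\to\infty$), and the increments $\Delta p_\ell=p^\ell-p^{\ell-1}$ satisfy $|\Delta p_\ell|\to0$ as $\ell\to\infty$.
   Context: Notation: $|\cdot|$ is the Euclidean norm, $\operatorname{dist}_{\mathcal A}(x)=\min_{\xi\in\mathcal A}|x-\xi|$, $\overline{\mathbb R}=\mathbb R\cup\{\infty\}$; gradients are column vectors. For a proper convex lower semicontinuous $f:\mathbb R^n\to\overline{\mathbb R}$, $\operatorname{prox}_f(x)=\arg\min_{y}\, f(y)+\tfrac12|x-y|^2$. The domain of $f$ is $\{x: f(x)<\infty\}$. Inner cost. Let $A:\mathbb R^l\to\mathbb R^{n\times n}$, $B:\mathbb R^l\to\mathbb R^{n\times m}$, $e:\mathbb R^l\to\mathbb R^n$ be smooth, let $R(p)\in\mathbb R^{m\times m}$ be symmetric positive definite and $Q(p),S(p)\in\mathbb R^{n\times n}$ be symmetric positive semidefinite, all smooth in $p\in\mathbb R^l$. Fix $x_0\in\mathbb R^n$ and a horizon $N\in\mathbb N$. For $\mathbf u=(u_0,\dots,u_{N-1})\in\mathbb R^{Nm}$ let $x_{k+1}=A(p)x_k+B(p)u_k+e(p)$ and $$J(\mathbf u,p)=\tfrac12x_N^\top S(p)x_N+\tfrac12\sum_{k=0}^{N-1}\big(x_k^\top Q(p)x_k+u_k^\top R(p)u_k\big).$$ Thus $J(\mathbf u,p)=\mathbf u^\top H(p)\mathbf u+g(p)^\top\mathbf u+c(p)$ with $H,g,c$ smooth in $p$ and $H(p)$ symmetric positive definite. Penalties. $P:\mathbb R^l\to\overline{\mathbb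 R}$ and $U:\mathbb R^{Nm}\to\overline{\mathbb R}$ are proper convex lower semicontinuous with compact domains $\mathcal P$ and $\mathcal U$. For $p\in\mathbb R^l$, $\bar{\mathbf u}(p)$ is the unique minimizer of $J(\cdot,p)+U(\cdot)$ and $\bar J(p)=\min_{\mathbf u}J(\mathbf u,p)+U(\mathbf u)$. (The map $\bar{\mathbf u}$ is locally Lipschitz, and $\bar J$ is differentiable with $\nabla\bar J(p)=\nabla_pJ(\mathbf u,p)|_{\mathbf u=\bar{\mathbf u}(p)}$.) Step-length assumption. $\nabla\bar J$ is Lipschitz continuous on $\mathcal P$ with constant $\nu^{-1}$, and for every $p\in\mathcal P$, $\nabla_{\mathbf u}J(\cdot,p)$ is Lipschitz continuous with constant $\mu^{-1}$. Size functions. A size function for a compact set $\mathcal A\subset\mathbb R^l$ (on $\mathbb R^l$) is a continuous function $\omega:\mathbb R^l\to\mathbb R_{\ge0}$ that vanishes exactly on $\mathcal A$ and satisfies $\omega(\xi_k)\to\infty$ whenever $|\xi_k|\to\infty$. Size-function assumption. (i) With $j^\star=\min(\bar J+P)$, the function $J_\star=\bar J+P-j^\star$ is a size function for $\mathcal P_\star$ in the extended-valued sense: it is finite and continuous on $\mathcal P$, equals $+\infty$ outside $\mathcal P$, and vanishes exactly on $\mathcal P_\star$. (ii) The function $\Lambda(p)=\big|\operatorname{prox}_{\nu P}[p-\nu\nabla\bar J(p)]-p\big|$ is a size function for $\mathcal P_\star$ on $\mathbb R^l$. *)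

theory Defs
  imports "HOL-Analysis.Analysis"
begin

section \<open>Smooth maps and gradients\<close>

text \<open>
  Class \<open>C\<^sup>k\<close> on the whole space, via directional derivatives along fixed vectors. Iterating these
  instead of the Frechet derivative keeps the codomain type unchanged; in finite dimension both
  give the usual notion.
\<close>

primrec Ck :: "nat \<Rightarrow> ('a::euclidean_space \<Rightarrow> 'b::real_normed_vector) \<Rightarrow> bool" where
  "Ck 0 f \<longleftrightarrow> continuous_on UNIV f"
| "Ck (Suc k) f \<longleftrightarrow>
     (\<forall>x. f differentiable at x) \<and> (\<forall>v. Ck k (\<lambda>x. frechet_derivative f (at x) v))"

definition smooth :: "('a::euclidean_space \<Rightarrow> 'b::real_normed_vector) \<Rightarrow> bool" where
  "smooth f \<longleftrightarrow> (\<forall>k. Ck k f)"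

definition gradient :: "('a::euclidean_space \<Rightarrow> real) \<Rightarrow> 'a \<Rightarrow> 'a" where
  "gradient f x = (THE g. GDERIV f x :> g)"


section \<open>Definite matrices\<close>

definition sym_pos_def :: "real^'n^'n \<Rightarrow> bool" where
  "sym_pos_def M \<longleftrightarrow> transpose M = M \<and> (\<forall>v. v \<noteq> 0 \<longrightarrow> v \<bullet> (M *v v) > 0)"

definition sym_pos_semidef :: "real^'n^'n \<Rightarrow> bool" where
  "sym_pos_semidef M \<longleftrightarrow> transpose M = M \<and> (\<forall>v. v \<bullet> (M *v v) \<ge> 0)"


section \<open>Extended-valued convex functions\<close>

definition proper :: "('a \<Rightarrow> ereal) \<Rightarrow> bool" where
  "proper f \<longleftrightarrow> (\<forall>x. f x \<noteq> -\<infinity>) \<and> (\<exists>x. f x \<noteq> \<infinity>)"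

definition convex_ereal :: "('a::real_vector \<Rightarrow> ereal) \<Rightarrow> bool" where
  "convex_ereal f \<longleftrightarrow>
     (\<forall>x y t. 0 < t \<and> t < 1 \<longrightarrow>
        f ((1 - t) *\<^sub>R x + t *\<^sub>R y) \<le> ereal (1 - t) * f x + ereal t * f y)"

text \<open>The punctured filter \<open>at x\<close> suffices below: \<open>y = x\<close> contributes \<open>f x\<close> itself.\<close>

definition lower_semicontinuous :: "('a::topological_space \<Rightarrow> ereal) \<Rightarrow> bool" where
  "lower_semicontinuous f \<longleftrightarrow> (\<forall>x. f x \<le> Liminf (at x) f)"

definition effective_domain :: "('a \<Rightarrow> ereal) \<Rightarrow> 'a set" where
  "effective_domain f = {x. f x < \<infinity>}"

definition prox :: "('a::real_normed_vector \<Rightarrow> ereal) \<Rightarrow> 'a \<Rightarrow> 'a" where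
  "prox f x = arg_min (\<lambda>y. f y + ereal (1/2 * (norm (x - y))\<^sup>2)) (\<lambda>_. True)"


section \<open>The inner optimal control cost\<close>

text \<open>
  An input sequence \<open>(u\<^sub>0, \<dots>, u\<^sub>N\<^sub>-\<^sub>1)\<close> is a vector of vectors \<open>u :: real^'m^'h\<close>, whose norm is the
  Euclidean norm on the stacked vector. The finite type \<open>'h\<close> indexes the stages, and
  \<open>\<sigma> :: nat \<Rightarrow> 'h\<close> is to be a bijection from \<open>{..<N}\<close>; thus \<open>u\<^sub>k\<close> is \<open>u $ \<sigma> k\<close>.
\<close>

primrec state ::
  "real^'n^'n \<Rightarrow> real^'m^'n \<Rightarrow> real^'n \<Rightarrow> real^'n \<Rightarrow> (nat \<Rightarrow> 'h::finite) \<Rightarrow> real^'m^'h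
     \<Rightarrow> nat \<Rightarrow> real^'n" where
  "state A B e x0 \<sigma> u 0 = x0"
| "state A B e x0 \<sigma> u (Suc k) = A *v state A B e x0 \<sigma> u k + B *v (u $ \<sigma> k) + e"

definition inner_cost ::
  "('p \<Rightarrow> real^'n^'n) \<Rightarrow> ('p \<Rightarrow> real^'m^'n) \<Rightarrow> ('p \<Rightarrow> real^'n) \<Rightarrow>
   ('p \<Rightarrow> real^'n^'n) \<Rightarrow> ('p \<Rightarrow> real^'m^'m) \<Rightarrow> ('p \<Rightarrow> real^'n^'n) \<Rightarrow>
   real^'n \<Rightarrow> nat \<Rightarrow> (nat \<Rightarrow> 'h::finite) \<Rightarrow> real^'m^'h \<Rightarrow> 'p \<Rightarrow> real" where
  "inner_cost A B e Q R S x0 N \<sigma> u p =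
     (let x = state (A p) (B p) (e p) x0 \<sigma> u
      in 1/2 * (x N \<bullet> (S p *v x N))
         + 1/2 * (\<Sum>k<N. x k \<bullet> (Q p *v x k) + u $ \<sigma> k \<bullet> (R p *v u $ \<sigma> k)))"

definition inner_minimizer :: "('u \<Rightarrow> 'p \<Rightarrow> real) \<Rightarrow> ('u \<Rightarrow> ereal) \<Rightarrow> 'p \<Rightarrow> 'u" where
  "inner_minimizer J U p = arg_min (\<lambda>u. ereal (J u p) + U u) (\<lambda>_. True)"

definition inner_value :: "('u \<Rightarrow> 'p \<Rightarrow> real) \<Rightarrow> ('u \<Rightarrow> ereal) \<Rightarrow> 'p \<Rightarrow> real" where
  "inner_value J U p = real_of_ereal (INF u. ereal (J u p) + U u)"


section \<open>Size functions\<close>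

text \<open>Compactness of \<open>A\<close> need not be required: it follows from the conditions on \<open>\<omega>\<close>.\<close>

definition size_function :: "('a::euclidean_space \<Rightarrow> real) \<Rightarrow> 'a set \<Rightarrow> bool" where
  "size_function \<omega> A \<longleftrightarrow>
     continuous_on UNIV \<omega> \<and> (\<forall>x. \<omega> x \<ge> 0) \<and> (\<forall>x. \<omega> x = 0 \<longleftrightarrow> x \<in> A) \<and>
     filterlim \<omega> at_top at_infinity"

text \<open>
  The extended-valued version, for functions equal to \<open>\<infinity>\<close> outside \<open>D\<close>. No growth condition
  is needed when \<open>D\<close> is bounded.
\<close>

definition size_function_ereal :: "('a::euclidean_space \<Rightarrow> ereal) \<Rightarrow> 'a set \<Rightarrow> 'a set \<Rightarrow> bool" where
  "size_function_ereal \<omega> D A \<longleftrightarrow>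
     (\<forall>x\<in>D. \<bar>\<omega> x\<bar> \<noteq> \<infinity>) \<and> continuous_on D \<omega> \<and> (\<forall>x. x \<notin> D \<longrightarrow> \<omega> x = \<infinity>) \<and>
     (\<forall>x. \<omega> x \<ge> 0) \<and> (\<forall>x. \<omega> x = 0 \<longleftrightarrow> x \<in> A)"


section \<open>The bilevel proximal gradient iteration\<close>

definition inner_step ::
  "('u::euclidean_space \<Rightarrow> 'p \<Rightarrow> real) \<Rightarrow> ('u \<Rightarrow> ereal) \<Rightarrow> real \<Rightarrow> 'p \<Rightarrow> 'u \<Rightarrow> 'u" where
  "inner_step J U \<mu> p u = prox (\<lambda>v. ereal \<mu> * U v) (u - \<mu> *\<^sub>R gradient (\<lambda>v. J v p) u)"

definition bilevel_step ::
  "('u::euclidean_space \<Rightarrow> 'p::euclidean_space \<Rightarrow> real) \<Rightarrow> ('u \<Rightarrow> ereal) \<Rightarrow> ('p \<Rightarrow> ereal) \<Rightarrow>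
   real \<Rightarrow> real \<Rightarrow> nat \<Rightarrow> 'u \<times> 'p \<Rightarrow> 'u \<times> 'p" where
  "bilevel_step J U P \<mu> \<nu> \<kappa> = (\<lambda>(u, p).
     let u' = (inner_step J U \<mu> p ^^ \<kappa>) u
     in (u', prox (\<lambda>q. ereal \<nu> * P q) (p - \<nu> *\<^sub>R gradient (\<lambda>q. J u' q) p)))"

definition asymptotically_stable ::
  "('z::metric_space \<Rightarrow> 'z) \<Rightarrow> 'z set \<Rightarrow> 'z set \<Rightarrow> bool" where
  "asymptotically_stable F X \<Omega> \<longleftrightarrow>
     (\<forall>\<epsilon>>0. \<exists>\<delta>>0. \<forall>z\<in>X. infdist z \<Omega> < \<delta> \<longrightarrow> (\<forall>l. infdist ((F ^^ l) z) \<Omega> < \<epsilon>)) \<and>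
     (\<forall>z\<in>X. (\<lambda>l. infdist ((F ^^ l) z) \<Omega>) \<longlonglongrightarrow> 0)"

end

(*
  The inner steps contract: with x the proximal gradient step from u, strong convexity of modulus m
  and step length mu give |x - ubar(p)|^2 <= (1 - mu m) |u - ubar(p)|^2. The outer step is a
  proximal gradient step for Jbar + P whose gradient error is at most a constant times
  |u - ubar(p)|, because grad Jbar(p) is the p-gradient of J at ubar(p). Since ubar is Lipschitz,
  for large kappa
    W(u, p) = J_star(p) + beta |u - ubar(p)|^2
  decreases by at least a multiple of |Delta p|^2 + |u - ubar(p)|^2 in every iteration. This sum
  therefore tends to 0, and with it Lambda(p), which is at most |Delta p| + nu L |u - ubar(p)|.
  On the compact set U x P, both W and Lambda(p) + |u - ubar(p)| vanish exactly on Omega, which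
  turns these facts into statements about the distance to Omega.
*)

theory Submission
  imports Defs
begin


section \<open>Closure properties of smooth maps\<close>

text \<open>The modulus \<open>m\<close> and the Lipschitz bounds must hold on an open set around
  \<P>: \<open>Jbar\<close> has to be differentiated at boundary points of \<P>, so minimizers at
  nearby parameters outside \<P> enter. Continuity of \<open>R\<close> on a closed ball supplies one
  positive modulus for all these parameters; the terms with \<open>Q\<close> and \<open>S\<close>
  only help. Differentiability of \<open>Jbar\<close> and the Lipschitz bound for
  \<open>ubar\<close> are derived. The obstacle in the coupling is that an outer step moves the
  target \<open>ubar\<close> of the inner iteration by up to \<open>L / m\<close> times |Delta p|.
  The weight \<beta> is made small enough for the outer descent to pay for this, and only afterwards
  is \<kappa> made large, so the choice is not circular. \<open>W\<close> is not shown to shrink by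
  a fixed fraction, because no rate relates J_star to Lambda. Hence the second function Lambda(p) +
  |u - ubar(p)|: \<open>W\<close> gives stability and a summable decrease, the second function turns
  a vanishing decrease into attraction.\<close>

lemma Ck_Suc_I:
  assumes "\<And>x. (f has_derivative f' x) (at x)" and "\<And>v. Ck k (\<lambda>x. f' x v)"
  shows "Ck (Suc k) f"
proof -
  have "frechet_derivative f (at x) = f' x" for x
    using frechet_derivative_at[OF assms(1)] by simp
  then show ?thesis
    using assms by (auto simp: differentiable_def)
qed

lemma Ck_Suc_has_derivative:
  "Ck (Suc k) f \<Longrightarrow> (f has_derivative frechet_derivative f (at x)) (at x)"
  by (simp add: frechet_derivative_works)

lemma Ck_SucD: "Ck (Suc k) f \<Longrightarrow> Ck k f"
proof (induction k arbitrary: f)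
  case 0
  then show ?case
    by (auto simp: continuous_on_eq_continuous_within differentiable_imp_continuous_within)
next
  case (Suc k)
  then show ?case by (auto simp del: Ck.simps(1))
qed

lemma Ck_const: "Ck k (\<lambda>x. c)"
proof (induction k arbitrary: c)
  case (Suc k)
  show ?case
    by (rule Ck_Suc_I[where f' = "\<lambda>_ _. 0"]) (auto intro: Suc)
qed simp

lemma Ck_linear: "bounded_linear f \<Longrightarrow> Ck k f"
proof (induction k)
  case 0
  then show ?case by (simp add: linear_continuous_on)
next
  case (Suc k)
  show ?case
    by (rule Ck_Suc_I[where f' = "\<lambda>_. f"])
      (auto intro: Ck_const bounded_linear_imp_has_derivative Suc)
qed

lemma Ck_add: "Ck k f \<Longrightarrow> Ck k g \<Longrightarrow> Ck k (\<lambda>x. f x + g x)"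
proof (induction k arbitrary: f g)
  case 0
  then show ?case by (auto intro: continuous_intros)
next
  case (Suc k)
  show ?case
    by (rule Ck_Suc_I, rule has_derivative_add[OF Ck_Suc_has_derivative[OF Suc.prems(1)]
          Ck_Suc_has_derivative[OF Suc.prems(2)]]) (use Suc in auto)
qed

lemma Ck_sum: "(\<And>i. i \<in> I \<Longrightarrow> Ck k (f i)) \<Longrightarrow> Ck k (\<lambda>x. \<Sum>i\<in>I. f i x)"
  by (induction I rule: infinite_finite_induct) (auto intro: Ck_const Ck_add)

text \<open>Each term of the product rule leaves one factor undifferentiated; \<open>Ck_SucD\<close>
  lowers the class of that factor so that the induction hypothesis applies.\<close>

lemma (in bounded_bilinear) Ck_prod:
  fixes f :: "'d::euclidean_space \<Rightarrow> 'a"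
  shows "Ck k f \<Longrightarrow> Ck k g \<Longrightarrow> Ck k (\<lambda>x. f x ** g x)"
proof (induction k arbitrary: f g)
  case 0
  then show ?case by (auto intro: continuous_on)
next
  case (Suc k)
  have "Ck k (\<lambda>x. f x ** frechet_derivative g (at x) v + frechet_derivative f (at x) v ** g x)" for v
    using Suc.prems Ck_SucD[OF Suc.prems(1)] Ck_SucD[OF Suc.prems(2)]
    by (intro Ck_add Suc.IH) auto
  then show ?case
    by (rule Ck_Suc_I[OF FDERIV[OF Ck_Suc_has_derivative[OF Suc.prems(1)]
            Ck_Suc_has_derivative[OF Suc.prems(2)]]])
qed

lemma Ck_compose_linear:
  fixes L :: "'a::euclidean_space \<Rightarrow> 'b::euclidean_space"
  assumes "bounded_linear L"
  shows "Ck k f \<Longrightarrow> Ck k (\<lambda>x. f (L x))"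
proof (induction k arbitrary: f)
  case 0
  then show ?case
    using continuous_on_compose2[of UNIV f UNIV L] linear_continuous_on[OF assms, of UNIV] by auto
next
  case (Suc k)
  show ?case
    by (rule Ck_Suc_I[where f' = "\<lambda>x v. frechet_derivative f (at (L x)) (L v)"],
        rule has_derivative_compose[OF bounded_linear_imp_has_derivative[OF assms]
          Ck_Suc_has_derivative[OF Suc.prems]])
      (use Suc in auto)
qed

text \<open>The derivatives along the finitely many basis vectors are continuous, hence bounded on
  \<open>D\<close>. Together they bound the operator norm, and convexity gives the mean value
  inequality.\<close>

lemma Ck_1_lipschitz_on:
  assumes f: "Ck 1 f" and D: "compact D" "convex D"
  obtains L where "L-lipschitz_on D f"
proof -
  let ?f' = "\<lambda>x. frechet_derivative f (at x)"
  have bounded: "\<exists>K. \<forall>x\<in>D. norm (?f' x b) \<le> K" for b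
  proof -
    have "continuous_on D (\<lambda>x. ?f' x b)"
      using f continuous_on_subset by fastforce
    then have "bounded ((\<lambda>x. ?f' x b) ` D)"
      using D by (simp add: compact_continuous_image compact_imp_bounded)
    then show ?thesis
      by (auto simp: bounded_iff)
  qed
  then obtain K where K: "\<And>b x. x \<in> D \<Longrightarrow> norm (?f' x b) \<le> K b"
    by metis
  have der: "(f has_derivative ?f' x) (at x)" for x
    using f frechet_derivative_works by fastforce
  \<comment> \<open>The absolute values keep \<open>L\<close> nonnegative even for empty
    \<open>D\<close>, where \<open>K b\<close> is arbitrary.\<close>
  define L where "L = (\<Sum>b\<in>Basis. \<bar>K b\<bar>)"
  have "onorm (?f' x) \<le> L" if x: "x \<in> D" for x
  proof (rule onorm_bound)
    fix h
    have lin: "linear (?f' x)"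
      using der has_derivative_linear by blast
    have "?f' x h = (\<Sum>b\<in>Basis. (h \<bullet> b) *\<^sub>R ?f' x b)"
      using linear_sum[OF lin, of "\<lambda>b. (h \<bullet> b) *\<^sub>R b" Basis] lin
      by (simp add: euclidean_representation linear_cmul)
    also have "norm \<dots> \<le> (\<Sum>b\<in>Basis. norm h * \<bar>K b\<bar>)"
    proof (rule sum_norm_le)
      fix b :: 'a assume b: "b \<in> Basis"
      show "norm ((h \<bullet> b) *\<^sub>R ?f' x b) \<le> norm h * \<bar>K b\<bar>"
        using Basis_le_norm[OF b, of h] K[OF x, of b] by (auto intro!: mult_mono)
    qed
    finally show "norm (?f' x h) \<le> L * norm h"
      by (simp add: L_def sum_distrib_left mult.commute)
  qed (simp add: L_def sum_nonneg)
  then have "norm (f x - f y) \<le> L * norm (x - y)" if "x \<in> D" "y \<in> D" for x y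
    using differentiable_bound[OF D(2) has_derivative_at_withinI[OF der]] that by blast
  then have "L-lipschitz_on D f"
    by (auto simp: lipschitz_on_def dist_norm L_def sum_nonneg)
  then show ?thesis ..
qed

lemma bounded_bilinear_matrix_vector_mult:
  "bounded_bilinear ((*v) :: real^'a^'b \<Rightarrow> real^'a \<Rightarrow> real^'b)"
  by (simp add: bilinear_conv_bounded_bilinear[symmetric] bilinear_def linear_iff
      matrix_vector_mult_add_rdistrib matrix_vector_right_distrib
      scaleR_matrix_vector_assoc matrix_vector_mult_scaleR)


section \<open>Gradients\<close>

lemma gradient_eqI: "GDERIV f x :> g \<Longrightarrow> gradient f x = g"
  unfolding gradient_def
proof (rule the_equality)
  fix d assume "GDERIV f x :> g" "GDERIV f x :> d"
  then have "(\<lambda>h. h \<bullet> d) = (\<lambda>h. h \<bullet> g)"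
    unfolding gderiv_def by (metis has_derivative_unique)
  then show "d = g"
    by (metis vector_eq_rdot inner_commute)
qed

text \<open>Riesz representation in coordinates: the gradient collects the values of the derivative
  on the basis.\<close>

lemma has_derivative_imp_GDERIV:
  fixes f :: "'a::euclidean_space \<Rightarrow> real"
  assumes "(f has_derivative f') (at x)"
  shows "GDERIV f x :> (\<Sum>b\<in>Basis. f' b *\<^sub>R b)"
proof -
  have lin: "linear f'"
    using assms has_derivative_linear by blast
  have "f' = (\<lambda>h. h \<bullet> (\<Sum>b\<in>Basis. f' b *\<^sub>R b))"
  proof
    fix h
    show "f' h = h \<bullet> (\<Sum>b\<in>Basis. f' b *\<^sub>R b)"
    using linear_sum[OF lin, of "\<lambda>b. (h \<bullet> b) *\<^sub>R b" Basis] lin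
      by (simp add: euclidean_representation linear_cmul inner_sum_right mult.commute)
  qed
  then show ?thesis
    using assms by (simp add: gderiv_def)
qed

lemma GDERIV_along_line:
  assumes "GDERIV f (x + t *\<^sub>R h) :> g"
  shows "((\<lambda>s. f (x + s *\<^sub>R h)) has_real_derivative h \<bullet> g) (at t)"
proof -
  have "((\<lambda>s. x + s *\<^sub>R h) has_derivative (\<lambda>s. s *\<^sub>R h)) (at t)"
    by (auto intro!: derivative_eq_intros)
  from has_derivative_compose[OF this assms[unfolded gderiv_def]] show ?thesis
    by (simp add: has_field_derivative_def mult_commute_abs)
qed

text \<open>Made for value functions, which have no explicit formula to differentiate but can be
  trapped between two quadratics.\<close>

lemma GDERIV_quadratic_boundI:
  assumes "open C" "x \<in> C"
    and bound: "\<And>y. y \<in> C \<Longrightarrow> \<bar>f y - f x - (y - x) \<bullet> g\<bar> \<le> M * (norm (y - x))\<^sup>2"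
  shows "GDERIV f x :> g"
  unfolding gderiv_def has_derivative_at_within
proof
  show "bounded_linear (\<lambda>h. h \<bullet> g)"
    by (rule bounded_linear_inner_left)
  have "((\<lambda>y. (f y - f x - (y - x) \<bullet> g) /\<^sub>R norm (y - x)) \<longlongrightarrow> 0) (at x)"
  proof (rule Lim_null_comparison)
    have "\<forall>\<^sub>F y in at x. y \<in> C"
      using assms by (simp add: eventually_at_in_open')
    then show "\<forall>\<^sub>F y in at x. norm ((f y - f x - (y - x) \<bullet> g) /\<^sub>R norm (y - x)) \<le> M * norm (y - x)"
      by eventually_elim
        (use bound in \<open>auto simp: divide_simps power2_eq_square mult_ac split: if_splits\<close>)
    show "((\<lambda>y. M * norm (y - x)) \<longlongrightarrow> 0) (at x)"
      by (auto intro!: tendsto_eq_intros)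
  qed
  then show "((\<lambda>y. (f y - f x - (y - x) \<bullet> g) /\<^sub>R norm (y - x)) \<longlongrightarrow> 0) (at x)" .
qed

lemma descent_lemma:
  fixes f :: "'a::real_inner \<Rightarrow> real"
  assumes "convex D" and D: "x \<in> D" "y \<in> D"
    and grad: "\<And>z. z \<in> D \<Longrightarrow> GDERIV f z :> g z"
    and lip: "L-lipschitz_on D g"
  shows "f y \<le> f x + (y - x) \<bullet> g x + L / 2 * (norm (y - x))\<^sup>2"
proof -
  define h where "h = y - x"
  \<comment> \<open>\<open>\<phi>\<close> is \<open>f\<close> on the segment minus its quadratic
    model; the Lipschitz bound on \<open>g\<close> says exactly that its derivative is at most
    0.\<close>
  define \<phi> where "\<phi> t = f (x + t *\<^sub>R h) - t * (h \<bullet> g x) - t\<^sup>2 * (L / 2 * (norm h)\<^sup>2)" for t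
  have mem: "x + t *\<^sub>R h \<in> D" if "0 \<le> t" "t \<le> 1" for t
    using \<open>convex D\<close> D that by (auto simp: convex_alt h_def algebra_simps)
  have "\<exists>d. (\<phi> has_real_derivative d) (at t) \<and> d \<le> 0" if t: "0 \<le> t" "t \<le> 1" for t
  proof (intro exI conjI)
    show "(\<phi> has_real_derivative
        h \<bullet> g (x + t *\<^sub>R h) - h \<bullet> g x - 2 * t * (L / 2 * (norm h)\<^sup>2)) (at t)"
      unfolding \<phi>_def
      by (auto intro!: derivative_eq_intros GDERIV_along_line grad mem t)
    have "h \<bullet> (g (x + t *\<^sub>R h) - g x) \<le> norm h * (L * norm (t *\<^sub>R h))"
      using norm_cauchy_schwarz[of h "g (x + t *\<^sub>R h) - g x"]
        lipschitz_on_normD[OF lip mem[OF t] D(1)]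
      by (smt (verit) add_diff_cancel_left' mult_left_mono norm_ge_zero)
    then show "h \<bullet> g (x + t *\<^sub>R h) - h \<bullet> g x - 2 * t * (L / 2 * (norm h)\<^sup>2) \<le> 0"
      using t by (simp add: inner_diff_right power2_eq_square algebra_simps)
  qed
  then have "\<phi> 1 \<le> \<phi> 0"
    using DERIV_nonpos_imp_nonincreasing[of 0 1 \<phi>] by simp
  then show ?thesis
    by (simp add: \<phi>_def h_def)
qed


section \<open>Penalties with compact domain and proximal maps\<close>

text \<open>An extended-valued penalty is traded for the real function \<open>r\<close> that represents it on its
  domain \<open>D\<close>; lower semicontinuity then only concerns \<open>D\<close>.\<close>

definition penalty_on :: "('a::euclidean_space \<Rightarrow> ereal) \<Rightarrow> 'a set \<Rightarrow> ('a \<Rightarrow> real) \<Rightarrow> bool" where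
  "penalty_on \<phi> D r \<longleftrightarrow> compact D \<and> D \<noteq> {} \<and> convex_on D r \<and>
     (\<forall>x\<in>D. \<forall>a<r x. \<forall>\<^sub>F y in at x within D. a < r y) \<and>
     (\<forall>x. \<phi> x = (if x \<in> D then ereal (r x) else \<infinity>))"

lemma penalty_onI:
  assumes \<phi>: "proper \<phi>" "convex_ereal \<phi>" "lower_semicontinuous \<phi>" "compact (effective_domain \<phi>)"
  shows "penalty_on \<phi> (effective_domain \<phi>) (\<lambda>x. real_of_ereal (\<phi> x))"
proof -
  let ?D = "effective_domain \<phi>" and ?r = "\<lambda>x. real_of_ereal (\<phi> x)"
  have r: "\<phi> x = ereal (?r x)" if "x \<in> ?D" for x
    using that \<phi>(1) by (auto simp: proper_def effective_domain_def ereal_real)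
  \<comment> \<open>One inequality serves twice: a finite upper bound at the intermediate point puts
    it into the domain, and there the bound is the convexity of \<open>?r\<close>.\<close>
  have seg: "(1 - t) *\<^sub>R x + t *\<^sub>R y \<in> ?D \<and>
      ?r ((1 - t) *\<^sub>R x + t *\<^sub>R y) \<le> (1 - t) * ?r x + t * ?r y"
    if t: "0 < t" "t < 1" and xy: "x \<in> ?D" "y \<in> ?D" for x y t
  proof -
    let ?z = "(1 - t) *\<^sub>R x + t *\<^sub>R y"
    have le: "\<phi> ?z \<le> ereal ((1 - t) * ?r x + t * ?r y)"
    proof -
      have "\<phi> ?z \<le> ereal (1 - t) * \<phi> x + ereal t * \<phi> y"
        using \<phi>(2) t by (auto simp: convex_ereal_def)
      then show ?thesis
        by (subst (asm) r[OF xy(1)], subst (asm) r[OF xy(2)]) simp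
    qed
    then have z: "?z \<in> ?D"
      unfolding effective_domain_def by (auto intro: order.strict_trans1)
    show ?thesis
      using z le by (subst (asm) r[OF z]) simp
  qed
  have "convex_on ?D ?r"
  proof (rule convex_onI)
    show "convex ?D"
      unfolding convex_alt
    proof (intro ballI allI impI)
      fix x y and t :: real
      assume "x \<in> ?D" "y \<in> ?D" "0 \<le> t \<and> t \<le> 1"
      then show "(1 - t) *\<^sub>R x + t *\<^sub>R y \<in> ?D"
        using seg[of t x y] by (cases "t = 0"; cases "t = 1") auto
    qed
  qed (use seg in blast)
  moreover have "\<forall>\<^sub>F y in at x within ?D. a < ?r y" if x: "x \<in> ?D" and a: "a < ?r x" for x a
  proof -
    have "ereal a < \<phi> x"
      using a by (subst r[OF x]) simp
    then have "\<forall>\<^sub>F y in at x. ereal a < \<phi> y"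
      using \<phi>(3) unfolding lower_semicontinuous_def le_Liminf_iff by blast
    then have "\<forall>\<^sub>F y in at x within ?D. ereal a < \<phi> y"
      by (rule filter_leD[OF at_le, rotated]) simp
    moreover have "\<forall>\<^sub>F y in at x within ?D. y \<in> ?D"
      by (simp add: eventually_at_filter)
    ultimately show ?thesis
      by eventually_elim (metis r less_ereal.simps(1))
  qed
  moreover have "\<phi> x = (if x \<in> ?D then ereal (?r x) else \<infinity>)" for x
    using r[of x] by (auto simp: effective_domain_def)
  moreover have "?D \<noteq> {}"
    using \<phi>(1) by (auto simp: proper_def effective_domain_def)
  ultimately show ?thesis
    using \<phi>(4) unfolding penalty_on_def by blast
qed

lemma penalty_on_scale:
  assumes "penalty_on \<phi> D r" "c > 0"
  shows "penalty_on (\<lambda>x. ereal c * \<phi> x) D (\<lambda>x. c * r x)"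
proof -
  have "\<forall>\<^sub>F y in at x within D. a < c * r y" if "x \<in> D" "a < c * r x" for a x
  proof -
    have "a / c < r x"
      using that assms(2) by (simp add: field_simps)
    then have "\<forall>\<^sub>F y in at x within D. a / c < r y"
      using assms(1) that(1) by (auto simp: penalty_on_def)
    then show ?thesis
      by eventually_elim (use assms(2) in \<open>simp add: field_simps\<close>)
  qed
  then show ?thesis
    using assms by (auto simp: penalty_on_def intro: convex_on_cmul)
qed

text \<open>By lower semicontinuity the strict superlevel sets at the levels \<open>?F y\<close> are
  relatively open. Without a minimizer they would cover \<open>D\<close>, but in a finite subcover
  the point of lowest level is left uncovered.\<close>

lemma penalty_on_attains_min:
  assumes \<phi>: "penalty_on \<phi> D r" and f: "continuous_on D f"
  obtains x where "x \<in> D" "\<And>y. y \<in> D \<Longrightarrow> f x + r x \<le> f y + r y"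
proof -
  let ?F = "\<lambda>x. f x + r x"
  have "\<exists>V. open V \<and> V \<inter> D = {z\<in>D. ?F y < ?F z}" for y
  proof -
    have "\<forall>\<^sub>F z in at x within D. ?F y < ?F z" if x: "x \<in> D" "?F y < ?F x" for x
    proof -
      \<comment> \<open>Half of the gap is granted to the continuous part \<open>f\<close> and half
        to \<open>r\<close>.\<close>
      define \<delta> where "\<delta> = (?F x - ?F y) / 2"
      have "\<delta> > 0"
        using x by (simp add: \<delta>_def)
      then have "\<forall>\<^sub>F z in at x within D. f x - \<delta> < f z"
        using f x by (intro order_tendstoD[of f "f x"]) (auto simp: continuous_on_def)
      moreover have "\<forall>\<^sub>F z in at x within D. r x - \<delta> < r z"
        using \<phi> x \<open>\<delta> > 0\<close> by (auto simp: penalty_on_def)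
      ultimately show ?thesis
        by eventually_elim (auto simp: \<delta>_def field_simps)
    qed
    then have "\<exists>V. open V \<and> x \<in> V \<and> (\<forall>z\<in>V \<inter> D. ?F y < ?F z)" if "x \<in> D" "?F y < ?F x" for x
      using that unfolding eventually_at_topological by fast
    then obtain V where V: "\<And>x. x \<in> D \<Longrightarrow> ?F y < ?F x \<Longrightarrow>
        open (V x) \<and> x \<in> V x \<and> (\<forall>z\<in>V x \<inter> D. ?F y < ?F z)"
      by metis
    then show ?thesis
      by (intro exI[of _ "\<Union>x\<in>{x\<in>D. ?F y < ?F x}. V x"]) auto
  qed
  then obtain V where V: "\<And>y. open (V y)" "\<And>y. V y \<inter> D = {z\<in>D. ?F y < ?F z}"
    by metis
  have D: "compact D" "D \<noteq> {}"
    using \<phi> by (auto simp: penalty_on_def)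
  show ?thesis
  proof (rule ccontr)
    assume "\<not> thesis"
    then have "\<forall>x\<in>D. \<exists>y\<in>D. ?F y < ?F x"
      using that by (meson not_le)
    then have "D \<subseteq> (\<Union>y\<in>D. V y)"
      using V(2) by blast
    then obtain T where T: "T \<subseteq> D" "finite T" "D \<subseteq> (\<Union>y\<in>T. V y)"
      using compactE_image[OF D(1), of D V] V(1) by metis
    then have "T \<noteq> {}"
      using D(2) by auto
    then obtain y where y: "y \<in> T" "\<And>z. z \<in> T \<Longrightarrow> ?F y \<le> ?F z"
      using ex_min_if_finite[of "?F ` T"] T(2)
      by (metis (no_types, lifting) arg_min_if_finite(1) arg_min_least)
    then obtain z where "z \<in> T" "y \<in> V z"
      using T by blast
    then have "?F z < ?F y"
      using V(2)[of z] y(1) T(1) by auto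
    then show False
      using y(2)[OF \<open>z \<in> T\<close>] by simp
  qed
qed

text \<open>\<open>arg_min\<close> is a Hilbert choice, so nothing is known about it until a
  minimizer has been exhibited. Infinite values then exclude points outside
  \<open>D\<close>.\<close>

lemma penalty_on_arg_min:
  assumes \<phi>: "penalty_on \<phi> D r" and f: "continuous_on D f"
    and x: "x = arg_min (\<lambda>y. ereal (f y) + \<phi> y) (\<lambda>_. True)"
  shows "x \<in> D" "\<And>y. y \<in> D \<Longrightarrow> f x + r x \<le> f y + r y"
proof -
  let ?G = "\<lambda>y. ereal (f y) + \<phi> y"
  have G: "?G y = (if y \<in> D then ereal (f y + r y) else \<infinity>)" for y
    using \<phi> by (simp add: penalty_on_def)
  obtain z where z: "z \<in> D" "\<And>y. y \<in> D \<Longrightarrow> f z + r z \<le> f y + r y"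
    using penalty_on_attains_min[OF \<phi> f] by blast
  have "is_arg_min ?G (\<lambda>_. True) z"
    using z by (auto simp: is_arg_min_def G not_less)
  then have x: "is_arg_min ?G (\<lambda>_. True) x"
    unfolding x arg_min_def by (rule someI)
  then show "x \<in> D"
    using z(1) by (auto simp: is_arg_min_def G split: if_splits)
  then show "f x + r x \<le> f y + r y" if "y \<in> D" for y
    using x that by (force simp: is_arg_min_def G not_less split: if_splits)
qed

text \<open>Replacing \<open>r\<close> on the segment from \<open>x\<close> to \<open>v\<close> by
  its chord gives, up to the constant \<open>r x\<close>, a differentiable majorant
  \<open>\<psi>\<close> that touches the objective at \<open>t = 0\<close>. A negative slope there
  would contradict minimality.\<close>

lemma penalty_on_first_order:
  assumes \<phi>: "penalty_on \<phi> D r" and f: "GDERIV f x :> d"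
    and x: "x \<in> D" "\<And>y. y \<in> D \<Longrightarrow> f x + r x \<le> f y + r y" and v: "v \<in> D"
  shows "r x - (v - x) \<bullet> d \<le> r v"
proof (rule ccontr)
  assume neg: "\<not> ?thesis"
  define \<psi> where "\<psi> t = f (x + t *\<^sub>R (v - x)) + t * (r v - r x)" for t
  have "(\<psi> has_real_derivative (v - x) \<bullet> d + (r v - r x)) (at 0)"
    unfolding \<psi>_def using f by (auto intro!: derivative_eq_intros GDERIV_along_line)
  from DERIV_neg_dec_right[OF this] neg obtain \<delta>
    where \<delta>: "\<delta> > 0" "\<And>t. 0 < t \<Longrightarrow> t < \<delta> \<Longrightarrow> \<psi> t < \<psi> 0"
    by auto
  define t where "t = min (\<delta> / 2) (1 / 2)"
  have t: "0 < t" "t < \<delta>" "t < 1"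
    using \<delta>(1) by (auto simp: t_def)
  have eq: "(1 - t) *\<^sub>R x + t *\<^sub>R v = x + t *\<^sub>R (v - x)"
    by (simp add: algebra_simps)
  have cvx: "convex_on D r"
    using \<phi> by (simp add: penalty_on_def)
  have "x + t *\<^sub>R (v - x) \<in> D"
    using convex_on_imp_convex[OF cvx] x(1) v t unfolding eq[symmetric] by (auto simp: convex_alt)
  moreover have "r (x + t *\<^sub>R (v - x)) \<le> (1 - t) * r x + t * r v"
    using convex_onD[OF cvx, of t x v] x(1) v t unfolding eq by simp
  ultimately have "\<psi> 0 \<le> \<psi> t"
    using x(2)[of "x + t *\<^sub>R (v - x)"] by (simp add: \<psi>_def algebra_simps)
  then show False
    using \<delta>(2)[of t] t by simp
qed

section \<open>Optimality and nonexpansiveness of the proximal map\<close>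

lemma GDERIV_half_dist_squared: "GDERIV (\<lambda>y. 1 / 2 * (norm (w - y))\<^sup>2) x :> x - w"
  unfolding gderiv_def power2_norm_eq_inner
  by (auto intro!: derivative_eq_intros simp: inner_commute algebra_simps)

text \<open>First-order optimality for the squared distance: \<open>w - prox \<phi> w\<close> acts
  as a subgradient of \<open>r\<close> at the proximal point. Every later fact about
  \<open>prox\<close> is drawn from this.\<close>

lemma prox_variational:
  assumes \<phi>: "penalty_on \<phi> D r"
  shows "prox \<phi> w \<in> D"
    and "v \<in> D \<Longrightarrow> r (prox \<phi> w) + (v - prox \<phi> w) \<bullet> (w - prox \<phi> w) \<le> r v"
proof -
  have cont: "continuous_on D (\<lambda>y. 1 / 2 * (norm (w - y))\<^sup>2)"
    by (intro continuous_intros)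
  have "prox \<phi> w = arg_min (\<lambda>y. ereal (1 / 2 * (norm (w - y))\<^sup>2) + \<phi> y) (\<lambda>_. True)"
    by (simp add: prox_def add.commute)
  note min = penalty_on_arg_min[OF \<phi> cont this]
  show "prox \<phi> w \<in> D"
    by (rule min(1))
  show "r (prox \<phi> w) + (v - prox \<phi> w) \<bullet> (w - prox \<phi> w) \<le> r v" if "v \<in> D"
    using penalty_on_first_order[OF \<phi> GDERIV_half_dist_squared min that]
    by (simp add: inner_diff_right)
qed

text \<open>Testing each proximal point in the inequality of the other and adding cancels
  \<open>r\<close>, as in the monotonicity of subgradients; Cauchy-Schwarz finishes.\<close>

lemma prox_nonexpansive:
  assumes \<phi>: "penalty_on \<phi> D r"
  shows "norm (prox \<phi> w - prox \<phi> w') \<le> norm (w - w')"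
proof -
  let ?x = "prox \<phi> w" and ?x' = "prox \<phi> w'"
  have "(?x - ?x') \<bullet> (?x - ?x') \<le> (?x - ?x') \<bullet> (w - w')"
    using prox_variational(2)[OF \<phi> prox_variational(1)[OF \<phi>], of w w']
      prox_variational(2)[OF \<phi> prox_variational(1)[OF \<phi>], of w' w]
    by (simp add: inner_diff_left inner_diff_right inner_commute)
  also have "\<dots> \<le> norm (?x - ?x') * norm (w - w')"
    by (rule norm_cauchy_schwarz)
  finally show ?thesis
    by (metis mult_left_le_imp_le norm_eq_zero norm_ge_zero norm_le_zero_iff not_le
        power2_eq_square power2_norm_eq_inner)
qed


section \<open>Lyapunov functions on compact sets\<close>

text \<open>On the compact set of points at distance at least \<open>\<epsilon>\<close> from
  \<open>\<Omega>\<close>, \<open>E\<close> attains a positive minimum, which serves as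
  \<open>\<eta>\<close>.\<close>

lemma infdist_less_if_small:
  fixes E :: "'z::metric_space \<Rightarrow> real"
  assumes X: "compact X" and E: "continuous_on X E" "\<And>z. z \<in> X \<Longrightarrow> E z \<ge> 0"
    and zero: "\<And>z. z \<in> X \<Longrightarrow> E z = 0 \<Longrightarrow> z \<in> \<Omega>" and "\<epsilon> > 0"
  obtains \<eta> where "\<eta> > 0" "\<And>z. z \<in> X \<Longrightarrow> E z < \<eta> \<Longrightarrow> infdist z \<Omega> < \<epsilon>"
proof (cases "X \<inter> {z. \<epsilon> \<le> infdist z \<Omega>} = {}")
  case True
  then show ?thesis
    using that[of 1] by force
next
  case False
  have "closed {z. \<epsilon> \<le> infdist z \<Omega>}"
    by (intro closed_Collect_le continuous_intros)
  then have "compact (X \<inter> {z. \<epsilon> \<le> infdist z \<Omega>})"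
    using X by blast
  from continuous_attains_inf[OF this False continuous_on_subset[OF E(1)]] obtain z0
    where z0: "z0 \<in> X" "\<epsilon> \<le> infdist z0 \<Omega>"
      and min: "\<And>z. z \<in> X \<Longrightarrow> \<epsilon> \<le> infdist z \<Omega> \<Longrightarrow> E z0 \<le> E z"
    by blast
  show ?thesis
  proof
    show "E z0 > 0"
      using z0 zero[of z0] E(2)[of z0] \<open>\<epsilon> > 0\<close> by (metis infdist_zero not_le order_le_less)
    show "infdist z \<Omega> < \<epsilon>" if "z \<in> X" "E z < E z0" for z
      using min[OF that(1)] that(2) by linarith
  qed
qed

text \<open>Uniform continuity compares \<open>z\<close> with a nearby point of
  \<open>\<Omega>\<close>. Such a point exists only for nonempty \<open>\<Omega>\<close>, since
  \<open>infdist\<close> to the empty set is 0 by convention.\<close>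

lemma small_if_infdist_less:
  fixes W :: "'z::metric_space \<Rightarrow> real"
  assumes X: "compact X" and W: "continuous_on X W"
    and \<Omega>: "\<Omega> \<subseteq> X" "\<Omega> \<noteq> {}" "\<And>z. z \<in> \<Omega> \<Longrightarrow> W z = 0" and "\<eta> > 0"
  obtains \<delta> where "\<delta> > 0" "\<And>z. z \<in> X \<Longrightarrow> infdist z \<Omega> < \<delta> \<Longrightarrow> W z < \<eta>"
proof -
  have "uniformly_continuous_on X W"
    using W X by (rule compact_uniformly_continuous)
  then obtain \<delta> where \<delta>: "\<delta> > 0" "\<And>x y. x \<in> X \<Longrightarrow> y \<in> X \<Longrightarrow> dist y x < \<delta> \<Longrightarrow> dist (W y) (W x) < \<eta>"
    using \<open>\<eta> > 0\<close> unfolding uniformly_continuous_on_def by meson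
  show ?thesis
  proof
    fix z assume z: "z \<in> X" "infdist z \<Omega> < \<delta>"
    then obtain a where "a \<in> \<Omega>" "dist z a < \<delta>"
      using \<Omega>(2) by (auto simp: infdist_def cINF_less_iff)
    then show "W z < \<eta>"
      using \<delta>(2)[of a z] z \<Omega> by (force simp: dist_real_def)
  qed (rule \<delta>(1))
qed

text \<open>Monotonicity of \<open>W\<close> along orbits gives stability. Telescoping bounds the
  sum of all decreases by the initial \<open>W\<close>, so \<open>D\<close> tends to 0;
  \<open>E\<close> is dominated by \<open>D\<close> and vanishes only on \<open>\<Omega>\<close>, so
  the orbit is driven there.\<close>

lemma asymptotically_stable_Lyapunov:
  fixes F :: "'z::metric_space \<Rightarrow> 'z" and W D E :: "'z \<Rightarrow> real"
  assumes X: "compact X" "F \<in> X \<rightarrow> X" and \<Omega>: "\<Omega> \<subseteq> X"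
    and W: "continuous_on X W" "\<And>z. z \<in> X \<Longrightarrow> W z \<ge> 0" "\<And>z. z \<in> X \<Longrightarrow> W z = 0 \<longleftrightarrow> z \<in> \<Omega>"
    and decrease: "\<And>z. z \<in> X \<Longrightarrow> W (F z) + D z \<le> W z" "\<And>z. z \<in> X \<Longrightarrow> D z \<ge> 0"
    and E: "continuous_on X E" "\<And>z. z \<in> X \<Longrightarrow> E z \<ge> 0" "\<And>z. z \<in> X \<Longrightarrow> E z = 0 \<Longrightarrow> z \<in> \<Omega>"
    and E_le: "\<And>z. z \<in> X \<Longrightarrow> (E z)\<^sup>2 \<le> C * D z"
  shows "asymptotically_stable F X \<Omega>" "\<And>z. z \<in> X \<Longrightarrow> (\<lambda>l. D ((F ^^ l) z)) \<longlonglongrightarrow> 0"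
proof -
  have orbit: "(F ^^ l) z \<in> X" if "z \<in> X" for z l
    using that X(2) by (induction l) auto
  have anti: "W ((F ^^ l) z) + (\<Sum>i<l. D ((F ^^ i) z)) \<le> W z" if "z \<in> X" for z l
  proof (induction l)
    case (Suc l)
    then show ?case
      using decrease(1)[OF orbit[OF that, of l]] by simp
  qed simp
  have W_le: "W ((F ^^ l) z) \<le> W z" if "z \<in> X" for z l
    using anti[OF that, of l] decrease(2)[OF orbit[OF that]]
      sum_nonneg[of "{..<l}" "\<lambda>i. D ((F ^^ i) z)"] by fastforce
  show D_lim: "(\<lambda>l. D ((F ^^ l) z)) \<longlonglongrightarrow> 0" if z: "z \<in> X" for z
  proof (rule summable_LIMSEQ_zero, rule bounded_imp_summable)
    show "(\<Sum>i\<le>l. D ((F ^^ i) z)) \<le> W z" for l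
      using anti[OF z, of "Suc l"] W(2)[OF orbit[OF z, of "Suc l"]]
      by (simp only: lessThan_Suc_atMost)
  qed (use decrease(2) orbit z in blast)
  have stable: "\<exists>\<delta>>0. \<forall>z\<in>X. infdist z \<Omega> < \<delta> \<longrightarrow> (\<forall>l. infdist ((F ^^ l) z) \<Omega> < \<epsilon>)"
    if \<epsilon>: "\<epsilon> > 0" for \<epsilon>
  \<comment> \<open>For empty \<open>\<Omega>\<close> all distances are 0 by convention, so the
    claim is trivial.\<close>
  proof (cases "\<Omega> = {}")
    case True
    then show ?thesis
      using \<epsilon> by (auto simp: infdist_def)
  next
    case False
    obtain \<eta> where \<eta>: "\<eta> > 0" "\<And>z. z \<in> X \<Longrightarrow> W z < \<eta> \<Longrightarrow> infdist z \<Omega> < \<epsilon>"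
      using infdist_less_if_small[OF X(1) W(1,2) _ \<epsilon>, of \<Omega>] W(3) by metis
    obtain \<delta> where \<delta>: "\<delta> > 0" "\<And>z. z \<in> X \<Longrightarrow> infdist z \<Omega> < \<delta> \<Longrightarrow> W z < \<eta>"
      using small_if_infdist_less[OF X(1) W(1) \<Omega> False _ \<eta>(1)] W(3) \<Omega> by (metis subsetD)
    show ?thesis
      using \<delta> \<eta> orbit W_le by (meson order_le_less_trans)
  qed
  have attract: "(\<lambda>l. infdist ((F ^^ l) z) \<Omega>) \<longlonglongrightarrow> 0" if z: "z \<in> X" for z
    unfolding tendsto_iff
  proof (intro allI impI)
    fix \<epsilon> :: real assume "\<epsilon> > 0"
    obtain \<eta> where \<eta>: "\<eta> > 0" "\<And>z. z \<in> X \<Longrightarrow> E z < \<eta> \<Longrightarrow> infdist z \<Omega> < \<epsilon>"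
      using infdist_less_if_small[OF X(1) E(1,2) _ \<open>\<epsilon> > 0\<close>, of \<Omega>] E(3) by metis
    have "(\<lambda>l. C * D ((F ^^ l) z)) \<longlonglongrightarrow> 0"
      using tendsto_mult_right_zero[OF D_lim[OF z]] by simp
    then have "\<forall>\<^sub>F l in sequentially. C * D ((F ^^ l) z) < \<eta>\<^sup>2"
      using \<eta>(1) by (intro order_tendstoD) auto
    then show "\<forall>\<^sub>F l in sequentially. dist (infdist ((F ^^ l) z) \<Omega>) 0 < \<epsilon>"
    proof eventually_elim
      case (elim l)
      then have "E ((F ^^ l) z) < \<eta>"
        using E_le[OF orbit[OF z, of l]] \<eta>(1) by (meson order_le_less_trans power2_less_imp_less less_imp_le)
      then show ?case
        using \<eta>(2) orbit[OF z] by (simp add: infdist_nonneg)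
    qed
  qed
  show "asymptotically_stable F X \<Omega>"
    using stable attract by (auto simp: asymptotically_stable_def)
qed


section \<open>Parametric composite minimization\<close>

lemma abs_diff_le_GDERIV_bound:
  assumes "convex C" "x \<in> C" "y \<in> C"
    and "\<And>z. z \<in> C \<Longrightarrow> GDERIV f z :> g z" "\<And>z. z \<in> C \<Longrightarrow> norm (g z) \<le> M"
  shows "\<bar>f x - f y\<bar> \<le> M * norm (x - y)"
proof -
  have "M \<ge> 0"
    using assms(5)[OF assms(2)] norm_ge_zero order_trans by blast
  have "onorm (\<lambda>h. h \<bullet> g z) \<le> M" if "z \<in> C" for z
  proof (rule onorm_bound)
    show "norm (h \<bullet> g z) \<le> M * norm h" for h
      using Cauchy_Schwarz_ineq2[of h "g z"] assms(5)[OF that]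
      by (smt (verit) mult.commute mult_left_mono norm_ge_zero real_norm_def)
  qed (rule \<open>M \<ge> 0\<close>)
  then show ?thesis
    using differentiable_bound[OF \<open>convex C\<close>, of f "\<lambda>z h. h \<bullet> g z" M x y] assms
    by (auto simp: gderiv_def has_derivative_at_withinI)
qed

text \<open>The stability argument freed from the control structure. \<open>C\<close> is an open
  convex neighbourhood of \<open>\<P>\<close>, which makes full gradients of \<open>Jbar\<close>
  available on all of \<open>\<P>\<close>. \<open>L\<close> bounds the variation of the p-gradient
  in both arguments at once: it controls the gradient error of an inexact inner solution as well as
  the drift of the minimizer.\<close>

locale bilevel_problem =
  fixes J :: "'u::euclidean_space \<Rightarrow> 'p::euclidean_space \<Rightarrow> real"
    and Gu :: "'u \<Rightarrow> 'p \<Rightarrow> 'u" and Gp :: "'u \<Rightarrow> 'p \<Rightarrow> 'p"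
    and U :: "'u \<Rightarrow> ereal" and \<U> :: "'u set" and rU :: "'u \<Rightarrow> real"
    and P :: "'p \<Rightarrow> ereal" and \<P> :: "'p set" and rP :: "'p \<Rightarrow> real"
    and C :: "'p set" and m L \<mu> \<nu> :: real
  assumes U: "penalty_on U \<U> rU" and P: "penalty_on P \<P> rP"
    and C: "open C" "convex C" "\<P> \<subseteq> C"
    and Gu: "\<And>u p. GDERIV (\<lambda>u. J u p) u :> Gu u p"
    and Gp: "\<And>u p. GDERIV (J u) p :> Gp u p"
    and pos: "m > 0" "L > 0" "\<mu> > 0" "\<nu> > 0"
    and strong: "\<And>u v p. p \<in> C \<Longrightarrow>
      J u p + (v - u) \<bullet> Gu u p + m / 2 * (norm (v - u))\<^sup>2 \<le> J v p"
    and Gp_lipschitz: "\<And>u v p q. \<lbrakk>u \<in> \<U>; v \<in> \<U>; p \<in> C; q \<in> C\<rbrakk> \<Longrightarrow>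
      norm (Gp u p - Gp v q) \<le> L * (norm (u - v) + norm (p - q))"
    and step_\<mu>: "\<And>p. p \<in> \<P> \<Longrightarrow> (1 / \<mu>)-lipschitz_on UNIV (\<lambda>u. Gu u p)"
    and step_\<nu>: "(1 / \<nu>)-lipschitz_on \<P> (gradient (inner_value J U))"
begin

abbreviation "ubar \<equiv> inner_minimizer J U"
abbreviation "Jbar \<equiv> inner_value J U"

lemma ubar_minimizes:
  shows "ubar p \<in> \<U>" and "v \<in> \<U> \<Longrightarrow> J (ubar p) p + rU (ubar p) \<le> J v p + rU v"
proof -
  have "continuous_on \<U> (\<lambda>u. J u p)"
    using Gu[unfolded gderiv_def]
    by (metis continuous_at_imp_continuous_on has_derivative_continuous)
  from penalty_on_arg_min[OF U this inner_minimizer_def[of J U p]]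
  show "ubar p \<in> \<U>" and "v \<in> \<U> \<Longrightarrow> J (ubar p) p + rU (ubar p) \<le> J v p + rU v"
    by auto
qed

text \<open>The first-order condition at the minimizer compensates the linear term in the strong
  convexity inequality.\<close>

lemma quadratic_growth:
  assumes "p \<in> C" "v \<in> \<U>"
  shows "J (ubar p) p + rU (ubar p) + m / 2 * (norm (v - ubar p))\<^sup>2 \<le> J v p + rU v"
proof -
  have "rU (ubar p) - (v - ubar p) \<bullet> Gu (ubar p) p \<le> rU v"
    using penalty_on_first_order[OF U Gu ubar_minimizes(1) _ assms(2)] ubar_minimizes(2) by blast
  then show ?thesis
    using strong[OF assms(1), of "ubar p" v] by linarith
qed

text \<open>The infimum is attained at a finite value, so \<open>real_of_ereal\<close> loses
  nothing.\<close>

lemma Jbar_eq: "Jbar p = J (ubar p) p + rU (ubar p)"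
proof -
  have eq: "ereal (J u p) + U u = (if u \<in> \<U> then ereal (J u p + rU u) else \<infinity>)" for u
    using U by (simp add: penalty_on_def)
  have "(INF u. ereal (J u p) + U u) = ereal (J (ubar p) p + rU (ubar p))"
  proof (rule antisym)
    show "(INF u. ereal (J u p) + U u) \<le> ereal (J (ubar p) p + rU (ubar p))"
      using ubar_minimizes(1) by (intro INF_lower2[of "ubar p"]) (auto simp: eq)
    show "ereal (J (ubar p) p + rU (ubar p)) \<le> (INF u. ereal (J u p) + U u)"
      using ubar_minimizes(2) by (intro INF_greatest) (auto simp: eq)
  qed
  then show ?thesis
    by (simp add: inner_value_def)
qed

text \<open>Adding the growth inequalities at \<open>p\<close> and at \<open>q\<close> cancels \<open>U\<close>, and bounds the squared
  distance of the minimizers by a mixed difference of \<open>J\<close>.\<close>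

lemma ubar_lipschitz:
  assumes "p \<in> C" "q \<in> C"
  shows "norm (ubar p - ubar q) \<le> L / m * norm (p - q)"
proof -
  let ?d = "norm (ubar p - ubar q)"
  let ?g = "\<lambda>x. J (ubar q) x - J (ubar p) x"
  have "m * ?d\<^sup>2 \<le> ?g p - ?g q"
    using quadratic_growth[OF assms(1) ubar_minimizes(1)[of q]]
      quadratic_growth[OF assms(2) ubar_minimizes(1)[of p]]
    by (simp add: norm_minus_commute)
  also have "\<dots> \<le> (L * ?d) * norm (p - q)"
  proof -
    have "GDERIV ?g z :> Gp (ubar q) z - Gp (ubar p) z" for z
      by (intro GDERIV_diff Gp)
    moreover have "norm (Gp (ubar q) z - Gp (ubar p) z) \<le> L * ?d" if "z \<in> C" for z
      using Gp_lipschitz[OF ubar_minimizes(1) ubar_minimizes(1) that that, of q p]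
      by (simp add: norm_minus_commute)
    ultimately have "\<bar>?g p - ?g q\<bar> \<le> (L * ?d) * norm (p - q)"
      by (rule abs_diff_le_GDERIV_bound[OF C(2) assms])
    then show ?thesis
      by linarith
  qed
  finally have "m * ?d * ?d \<le> L * norm (p - q) * ?d"
    by (simp add: power2_eq_square mult_ac)
  then have "m * ?d \<le> L * norm (p - q)"
    using pos by (cases "?d = 0") (auto simp: mult_le_cancel_right)
  then show ?thesis
    using pos by (simp add: field_simps)
qed

section \<open>Differentiability of the value function\<close>

lemma J_taylor:
  assumes "u \<in> \<U>" "p \<in> C" "q \<in> C"
  shows "J u q \<le> J u p + (q - p) \<bullet> Gp u p + L / 2 * (norm (q - p))\<^sup>2"
proof -
  have "L-lipschitz_on C (Gp u)"
    using Gp_lipschitz[OF assms(1) assms(1)] pos by (auto simp: lipschitz_on_def dist_norm)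
  from descent_lemma[OF C(2) assms(2,3) Gp this] show ?thesis .
qed

text \<open>Envelope argument: using the minimizer of one parameter as a competitor at the other
  bounds the increment of \<open>Jbar\<close> from both sides. As \<open>ubar\<close> is Lipschitz,
  the two linear terms differ only to second order.\<close>

lemma Jbar_GDERIV:
  assumes "p \<in> C"
  shows "GDERIV Jbar p :> Gp (ubar p) p"
proof (rule GDERIV_quadratic_boundI[OF C(1) assms])
  fix q assume q: "q \<in> C"
  define n where "n = norm (q - p)"
  have upper: "Jbar q - Jbar p \<le> (q - p) \<bullet> Gp (ubar p) p + L / 2 * n\<^sup>2"
    using ubar_minimizes(2)[OF ubar_minimizes(1)[of p], of q]
      J_taylor[OF ubar_minimizes(1) assms q, of p] by (simp add: Jbar_eq n_def)
  have "(q - p) \<bullet> (Gp (ubar p) p - Gp (ubar q) q) \<le> n * (L * ((L / m) * n + n))"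
  proof -
    have "norm (Gp (ubar p) p - Gp (ubar q) q) \<le> L * (norm (ubar p - ubar q) + norm (p - q))"
      by (intro Gp_lipschitz ubar_minimizes assms q)
    also have "\<dots> \<le> L * ((L / m) * n + n)"
      using ubar_lipschitz[OF assms q] pos by (simp add: n_def norm_minus_commute)
    finally show ?thesis
      using norm_cauchy_schwarz[of "q - p" "Gp (ubar p) p - Gp (ubar q) q"]
      by (smt (verit) mult_left_mono norm_ge_zero n_def)
  qed
  \<comment> \<open>The roles are exchanged, so the gradient sits at \<open>q\<close>; the preceding
    bound moves it to \<open>p\<close>.\<close>
  moreover have "Jbar q - Jbar p \<ge> (q - p) \<bullet> Gp (ubar q) q - L / 2 * n\<^sup>2"
    using ubar_minimizes(2)[OF ubar_minimizes(1)[of q], of p]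
      J_taylor[OF ubar_minimizes(1) q assms, of q]
    by (simp add: Jbar_eq n_def inner_diff_left norm_minus_commute)
  ultimately have lower: "Jbar q - Jbar p - (q - p) \<bullet> Gp (ubar p) p \<ge> - ((L * (L / m + 1) + L / 2) * n\<^sup>2)"
    by (simp add: inner_diff_right power2_eq_square algebra_simps)
  have "L / 2 * n\<^sup>2 \<le> (L * (L / m + 1) + L / 2) * n\<^sup>2"
    using pos by (intro mult_right_mono) auto
  then show "\<bar>Jbar q - Jbar p - (q - p) \<bullet> Gp (ubar p) p\<bar>
      \<le> (L * (L / m + 1) + L / 2) * (norm (q - p))\<^sup>2"
    using upper lower unfolding n_def[symmetric] abs_le_iff by linarith
qed


section \<open>Contraction of the inner and descent of the outer iteration\<close>

text \<open>The \<open>max 0\<close> makes the factor nonnegative without comparing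
  \<open>\<mu>\<close> with \<open>1 / m\<close>, so that the estimate can be iterated.\<close>

lemma inner_step_contraction:
  fixes u :: 'u
  assumes p: "p \<in> \<P>"
  defines "x \<equiv> inner_step J U \<mu> p u"
  shows "x \<in> \<U>" and "(norm (x - ubar p))\<^sup>2 \<le> max 0 (1 - \<mu> * m) * (norm (u - ubar p))\<^sup>2"
proof -
  note \<mu>U = penalty_on_scale[OF U pos(3)]
  let ?b = "ubar p" and ?g = "Gu u p"
  have x: "x = prox (\<lambda>v. ereal \<mu> * U v) (u - \<mu> *\<^sub>R ?g)"
    by (simp add: x_def inner_step_def gradient_eqI[OF Gu])
  show xU: "x \<in> \<U>"
    unfolding x by (rule prox_variational(1)[OF \<mu>U])
  have pC: "p \<in> C"
    using p C by blast
  \<comment> \<open>In the sum of the next four inequalities all values of \<open>J\<close> and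
    \<open>rU\<close> cancel, as do \<open>gx\<close> and \<open>gb\<close>. What remains bounds
    \<open>cross\<close>, and expanding the squared distance turns this into the
    contraction.\<close>
  define cross where "cross = (?b - x) \<bullet> (u - x)"
  define gx where "gx = (x - u) \<bullet> ?g"
  define gb where "gb = (?b - u) \<bullet> ?g"
  have "\<mu> * rU x + (?b - x) \<bullet> (u - \<mu> *\<^sub>R ?g - x) \<le> \<mu> * rU ?b"
    unfolding x by (rule prox_variational(2)[OF \<mu>U ubar_minimizes(1)])
  then have "\<mu> * rU x + cross - \<mu> * (gb - gx) \<le> \<mu> * rU ?b"
    by (simp add: cross_def gx_def gb_def inner_diff_left inner_diff_right algebra_simps)
  moreover have "\<mu> * J x p \<le> \<mu> * (J u p + gx) + 1 / 2 * (norm (x - u))\<^sup>2"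
    using descent_lemma[OF convex_UNIV UNIV_I UNIV_I Gu step_\<mu>[OF p], of x u] pos
    by (simp add: gx_def field_simps)
  moreover have "\<mu> * (J u p + gb) + \<mu> * m / 2 * (norm (?b - u))\<^sup>2 \<le> \<mu> * J ?b p"
    using mult_left_mono[OF strong[OF pC, of u ?b], of \<mu>] pos
    by (simp add: gb_def algebra_simps)
  moreover have "\<mu> * (J ?b p + rU ?b) \<le> \<mu> * (J x p + rU x)"
    using ubar_minimizes(2)[OF xU] pos by simp
  moreover have "(norm (?b - x))\<^sup>2 = (norm (?b - u))\<^sup>2 - (norm (x - u))\<^sup>2 + 2 * cross"
    by (simp add: cross_def power2_norm_eq_inner inner_diff_left inner_diff_right inner_commute)
  ultimately have "(norm (?b - x))\<^sup>2 \<le> (1 - \<mu> * m) * (norm (?b - u))\<^sup>2"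
    by (simp add: algebra_simps)
  also have "\<dots> \<le> max 0 (1 - \<mu> * m) * (norm (?b - u))\<^sup>2"
    by (intro mult_right_mono) auto
  finally show "(norm (x - ?b))\<^sup>2 \<le> max 0 (1 - \<mu> * m) * (norm (u - ?b))\<^sup>2"
    by (simp add: norm_minus_commute)
qed

lemma inner_iteration_contraction:
  fixes \<kappa> :: nat
  assumes p: "p \<in> \<P>" and u: "u \<in> \<U>"
  defines "x \<equiv> (inner_step J U \<mu> p ^^ \<kappa>) u"
  shows "x \<in> \<U>" and "(norm (x - ubar p))\<^sup>2 \<le> max 0 (1 - \<mu> * m) ^ \<kappa> * (norm (u - ubar p))\<^sup>2"
  unfolding x_def
proof (induction \<kappa>)
  case (Suc \<kappa>)
  {
    case 1
    show ?case
      by (simp add: inner_step_contraction(1)[OF p])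
  next
    case 2
    show ?case
      using order_trans[OF inner_step_contraction(2)[OF p] mult_left_mono[OF Suc(2)]]
      by (simp add: mult_ac)
  }
qed (use u in auto)

text \<open>The proximal inequality tested with the old \<open>p\<close> yields 1 / \<nu>, and the
  descent lemma for \<open>Jbar\<close> gives back half of it. The mismatch of the two gradients is
  the error term. For the last claim, nonexpansiveness compares the actual step with the step along
  the exact gradient.\<close>

lemma outer_step_descent:
  assumes p: "p \<in> \<P>" and u: "u \<in> \<U>"
  defines "p' \<equiv> prox (\<lambda>q. ereal \<nu> * P q) (p - \<nu> *\<^sub>R gradient (J u) p)"
  shows "p' \<in> \<P>"
    and "Jbar p' + rP p' + (norm (p' - p))\<^sup>2 / (2 * \<nu>)
      \<le> Jbar p + rP p + L * norm (p' - p) * norm (u - ubar p)"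
    and "norm (prox (\<lambda>q. ereal \<nu> * P q) (p - \<nu> *\<^sub>R gradient Jbar p) - p)
      \<le> norm (p' - p) + \<nu> * L * norm (u - ubar p)"
proof -
  note \<nu>P = penalty_on_scale[OF P pos(4)]
  let ?g = "Gp u p" and ?g' = "Gp (ubar p) p"
  have pC: "p \<in> C"
    using p C by blast
  have p': "p' = prox (\<lambda>q. ereal \<nu> * P q) (p - \<nu> *\<^sub>R ?g)"
    by (simp add: p'_def gradient_eqI[OF Gp])
  show p'P: "p' \<in> \<P>"
    unfolding p' by (rule prox_variational(1)[OF \<nu>P])
  have grad: "gradient Jbar q = Gp (ubar q) q" if "q \<in> \<P>" for q
    using that C by (intro gradient_eqI Jbar_GDERIV) auto
  have diff: "norm (?g' - ?g) \<le> L * norm (u - ubar p)"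
    using Gp_lipschitz[OF ubar_minimizes(1) u pC pC, of p] by (simp add: norm_minus_commute)
  have "\<nu> * rP p' + (p - p') \<bullet> (p - \<nu> *\<^sub>R ?g - p') \<le> \<nu> * rP p"
    unfolding p' by (rule prox_variational(2)[OF \<nu>P p])
  moreover have "(p - p') \<bullet> (p - \<nu> *\<^sub>R ?g - p') = (norm (p' - p))\<^sup>2 + \<nu> * ((p' - p) \<bullet> ?g)"
    by (simp add: power2_norm_eq_inner inner_diff_left inner_diff_right inner_commute algebra_simps)
  ultimately have "rP p' + (norm (p' - p))\<^sup>2 / \<nu> + (p' - p) \<bullet> ?g \<le> rP p"
    using pos by (simp add: field_simps)
  moreover have "Jbar p' \<le> Jbar p + (p' - p) \<bullet> ?g' + (1 / \<nu>) / 2 * (norm (p' - p))\<^sup>2"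
  proof -
    have "convex \<P>"
      using P convex_on_imp_convex by (auto simp: penalty_on_def)
    moreover have "GDERIV Jbar q :> gradient Jbar q" if "q \<in> \<P>" for q
      using Jbar_GDERIV[of q] grad[OF that] that C by auto
    ultimately show ?thesis
      using descent_lemma[OF _ p p'P _ step_\<nu>] grad[OF p] by metis
  qed
  moreover have "(p' - p) \<bullet> (?g' - ?g) \<le> norm (p' - p) * (L * norm (u - ubar p))"
    using norm_cauchy_schwarz[of "p' - p" "?g' - ?g"] mult_left_mono[OF diff, of "norm (p' - p)"]
    by simp
  ultimately show "Jbar p' + rP p' + (norm (p' - p))\<^sup>2 / (2 * \<nu>)
      \<le> Jbar p + rP p + L * norm (p' - p) * norm (u - ubar p)"
    by (simp add: inner_diff_right field_simps)
  let ?q = "prox (\<lambda>q. ereal \<nu> * P q) (p - \<nu> *\<^sub>R gradient Jbar p)"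
  have "norm (?q - p') \<le> norm (\<nu> *\<^sub>R (?g - ?g'))"
    unfolding p' using prox_nonexpansive[OF \<nu>P, of "p - \<nu> *\<^sub>R ?g'" "p - \<nu> *\<^sub>R ?g"]
    by (simp add: grad[OF p] algebra_simps)
  also have "\<dots> \<le> \<nu> * (L * norm (u - ubar p))"
    using diff pos by (simp add: norm_minus_commute)
  finally show "norm (?q - p) \<le> norm (p' - p) + \<nu> * L * norm (u - ubar p)"
    using norm_triangle_ineq[of "?q - p'" "p' - p"] by (simp add: mult.assoc)
qed


section \<open>Asymptotic stability of the coupled iteration\<close>

text \<open>The weight \<open>\<beta> = 1 / (16 \<nu> l\<^sup>2)\<close> is small enough for the drift of the inner minimizer to be
  absorbed by the descent of the outer step; then \<open>\<theta>\<close>, that is \<open>\<kappa>\<close>, is chosen last.\<close>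

lemma composite_decrease:
  fixes d e e' s V V' \<theta> l \<beta> :: real
  assumes s: "s\<^sup>2 \<le> \<theta> * e\<^sup>2" and e': "0 \<le> e'" "e' \<le> s + l * d"
    and V: "V' + d\<^sup>2 / (2 * \<nu>) \<le> V + L * d * s"
    and \<beta>: "\<beta> \<ge> 0" "16 * \<nu> * \<beta> * l\<^sup>2 = 1" and \<theta>: "\<theta> * (2 * \<beta> + 2 * \<nu> * L\<^sup>2) \<le> \<beta> / 2"
  shows "V' + \<beta> * e'\<^sup>2 + (d\<^sup>2 / (4 * \<nu>) + \<beta> / 2 * e\<^sup>2) \<le> V + \<beta> * e\<^sup>2"
proof -
  \<comment> \<open>Here \<open>d\<close> is the length of the outer step; \<open>e\<close> and
    \<open>s\<close> are the distances to the old inner minimizer before and after the inner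
    iteration, and \<open>e'\<close> is the distance to the new one. The descent
    \<open>d\<^sup>2 / (2 * \<nu>)\<close> is spent exactly: a quarter on this Young inequality, a
    quarter on the drift, and half is kept.\<close>
  have "L * d * s \<le> d\<^sup>2 / (8 * \<nu>) + 2 * \<nu> * L\<^sup>2 * s\<^sup>2"
    using zero_le_power2[of "d - 4 * \<nu> * L * s"] pos by (simp add: field_simps power2_eq_square)
  moreover have "\<beta> * e'\<^sup>2 \<le> \<beta> * (2 * s\<^sup>2 + 2 * l\<^sup>2 * d\<^sup>2)"
  proof (rule mult_left_mono[OF _ \<beta>(1)])
    have "e'\<^sup>2 \<le> (s + l * d)\<^sup>2"
      using e' by (intro power_mono)
    also have "\<dots> \<le> 2 * s\<^sup>2 + 2 * l\<^sup>2 * d\<^sup>2"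
      using zero_le_power2[of "s - l * d"] by (simp add: power2_eq_square algebra_simps)
    finally show "e'\<^sup>2 \<le> 2 * s\<^sup>2 + 2 * l\<^sup>2 * d\<^sup>2" .
  qed
  moreover have "\<beta> * l\<^sup>2 * d\<^sup>2 = d\<^sup>2 / (16 * \<nu>)"
  proof -
    have "\<beta> * l\<^sup>2 = 1 / (16 * \<nu>)"
      using \<beta>(2) pos by (simp add: field_simps)
    then show ?thesis
      by simp
  qed
  \<comment> \<open>The two summands stem from the drift and from the Young inequality; together
    they use up at most half of \<open>\<beta> * e\<^sup>2\<close>.\<close>
  moreover have "(2 * \<beta> + 2 * \<nu> * L\<^sup>2) * s\<^sup>2 \<le> \<beta> / 2 * e\<^sup>2"
  proof -
    have "(2 * \<beta> + 2 * \<nu> * L\<^sup>2) * s\<^sup>2 \<le> (2 * \<beta> + 2 * \<nu> * L\<^sup>2) * (\<theta> * e\<^sup>2)"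
      using s \<beta> pos by (intro mult_left_mono) auto
    also have "\<dots> = \<theta> * (2 * \<beta> + 2 * \<nu> * L\<^sup>2) * e\<^sup>2"
      by simp
    also have "\<dots> \<le> \<beta> / 2 * e\<^sup>2"
      using \<theta> by (intro mult_right_mono) auto
    finally show ?thesis .
  qed
  ultimately show ?thesis
    using V by (simp add: algebra_simps)
qed

theorem bilevel_iteration_stable:
  fixes Js \<Lambda> :: "'p \<Rightarrow> real"
  defines "\<Lambda> \<equiv> \<lambda>p. norm (prox (\<lambda>q. ereal \<nu> * P q) (p - \<nu> *\<^sub>R gradient Jbar p) - p)"
  assumes Js: "continuous_on \<P> Js" "\<And>p. p \<in> \<P> \<Longrightarrow> Js p \<ge> 0"
      "\<And>p. p \<in> \<P> \<Longrightarrow> Js p = 0 \<longleftrightarrow> p \<in> Pstar" "\<And>p. p \<in> \<P> \<Longrightarrow> Js p = Jbar p + rP p - c"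
    and Pstar: "Pstar \<subseteq> \<P>"
    and \<Lambda>: "continuous_on \<P> \<Lambda>" "\<And>p. p \<in> \<P> \<Longrightarrow> \<Lambda> p = 0 \<Longrightarrow> p \<in> Pstar"
  shows "\<exists>K. \<forall>\<kappa>\<ge>K. let F = bilevel_step J U P \<mu> \<nu> \<kappa> in
    asymptotically_stable F (\<U> \<times> \<P>) {(ubar p, p) | p. p \<in> Pstar} \<and>
    (\<forall>z\<in>\<U> \<times> \<P>. (\<lambda>l. norm (snd ((F ^^ Suc l) z) - snd ((F ^^ l) z))) \<longlonglongrightarrow> 0)"
proof -
  define q where "q = max 0 (1 - \<mu> * m)"
  define l where "l = L / m"
  define \<beta> where "\<beta> = 1 / (16 * \<nu> * l\<^sup>2)"
  have q: "0 \<le> q" "q < 1"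
    using pos by (auto simp: q_def)
  have l: "l > 0"
    using pos by (simp add: l_def)
  have \<beta>: "\<beta> > 0" "16 * \<nu> * \<beta> * l\<^sup>2 = 1"
    using pos l by (auto simp: \<beta>_def)
  \<comment> \<open>The threshold depends only on \<open>m\<close>, \<open>L\<close>,
    \<open>\<mu>\<close> and \<open>\<nu>\<close>, so one \<open>K\<close> serves all initial
    points.\<close>
  have "(\<lambda>\<kappa>. q ^ \<kappa> * (2 * \<beta> + 2 * \<nu> * L\<^sup>2)) \<longlonglongrightarrow> 0"
    using q by (intro tendsto_mult_left_zero LIMSEQ_realpow_zero)
  then have "\<forall>\<^sub>F \<kappa> in sequentially. q ^ \<kappa> * (2 * \<beta> + 2 * \<nu> * L\<^sup>2) < \<beta> / 2"
    using \<beta> by (intro order_tendstoD) auto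
  then obtain K where K: "\<And>\<kappa>. \<kappa> \<ge> K \<Longrightarrow> q ^ \<kappa> * (2 * \<beta> + 2 * \<nu> * L\<^sup>2) < \<beta> / 2"
    by (auto simp: eventually_sequentially)
  show ?thesis
  proof (intro exI[of _ K] allI impI)
    fix \<kappa> assume "\<kappa> \<ge> K"
    define F where "F = bilevel_step J U P \<mu> \<nu> \<kappa>"
    define \<Omega> where "\<Omega> = {(ubar p, p) | p. p \<in> Pstar}"
    define err where "err z = norm (fst z - ubar (snd z))" for z :: "'u \<times> 'p"
    define incr where "incr z = norm (snd (F z) - snd z)" for z
    define W where "W z = Js (snd z) + \<beta> * (err z)\<^sup>2" for z
    define D where "D z = (incr z)\<^sup>2 / (4 * \<nu>) + \<beta> / 2 * (err z)\<^sup>2" for z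
    define E where "E z = \<Lambda> (snd z) + err z" for z
    have X: "compact (\<U> \<times> \<P>)"
      using U P by (simp add: penalty_on_def compact_Times)
    have "l-lipschitz_on \<P> ubar"
      using ubar_lipschitz C(3) l by (auto simp: lipschitz_on_def dist_norm l_def)
    note cont_ubar = lipschitz_on_continuous_on[OF this]
    have cont_snd: "continuous_on (\<U> \<times> \<P>) (\<lambda>z. f (snd z))"
      if "continuous_on \<P> f" for f :: "'p \<Rightarrow> 'b::topological_space"
      by (rule continuous_on_compose2[OF that continuous_on_snd[OF continuous_on_id]]) auto
    have cont_err: "continuous_on (\<U> \<times> \<P>) err"
      unfolding err_def by (intro continuous_intros cont_snd cont_ubar)
    have step: "snd (F z) \<in> \<P> \<and> fst (F z) \<in> \<U> \<and>
        W (F z) + D z \<le> W z \<and> \<Lambda> (snd z) \<le> incr z + \<nu> * L * err z" if z: "z \<in> \<U> \<times> \<P>" for z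
    proof -
      obtain u p where up: "z = (u, p)" "u \<in> \<U>" "p \<in> \<P>"
        using z by auto
      define u' where "u' = (inner_step J U \<mu> p ^^ \<kappa>) u"
      define p' where "p' = prox (\<lambda>q. ereal \<nu> * P q) (p - \<nu> *\<^sub>R gradient (J u') p)"
      have F: "F (u, p) = (u', p')"
        by (simp add: F_def bilevel_step_def Let_def u'_def p'_def)
      note inner = inner_iteration_contraction[OF up(3,2), of \<kappa>, folded u'_def q_def]
      note outer = outer_step_descent[OF up(3) inner(1), folded p'_def]
      have "norm (u' - ubar p') \<le> norm (u' - ubar p) + norm (ubar p - ubar p')"
        using norm_triangle_ineq[of "u' - ubar p" "ubar p - ubar p'"] by simp
      also have "norm (ubar p - ubar p') \<le> l * norm (p' - p)"
        using ubar_lipschitz[of p p'] outer(1) up C(3) by (auto simp: l_def norm_minus_commute)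
      finally have drift: "norm (u' - ubar p') \<le> norm (u' - ubar p) + l * norm (p' - p)"
        by simp
      have "W (F z) + D z \<le> W z"
        using composite_decrease[OF inner(2) norm_ge_zero drift outer(2) less_imp_le[OF \<beta>(1)] \<beta>(2)
            less_imp_le[OF K[OF \<open>\<kappa> \<ge> K\<close>]]] Js(4)[OF outer(1)] Js(4)[OF up(3)]
        by (simp add: W_def D_def err_def incr_def F up)
      moreover have "\<Lambda> p \<le> norm (p' - p) + \<nu> * L * norm (u - ubar p)"
      proof -
        \<comment> \<open>The outer estimate involves the error after the inner iteration; it is
          replaced by the error before, the one that occurs in \<open>D z\<close>.\<close>
        have "(norm (u' - ubar p))\<^sup>2 \<le> (norm (u - ubar p))\<^sup>2"
          using order_trans[OF inner(2) mult_right_mono[OF power_le_one[OF q(1) less_imp_le[OF q(2)]]]]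
          by simp
        then have "norm (u' - ubar p) \<le> norm (u - ubar p)"
          by (rule power2_le_imp_le) simp
        then have "\<nu> * L * norm (u' - ubar p) \<le> \<nu> * L * norm (u - ubar p)"
          using pos by (intro mult_left_mono) auto
        then show ?thesis
          using outer(3) by (simp add: \<Lambda>_def)
      qed
      ultimately show ?thesis
        using inner(1) outer(1) by (simp add: err_def incr_def F up)
    qed
    define a where "a = min (1 / (4 * \<nu>)) (\<beta> / 2)"
    have a: "a > 0" "a \<le> 1 / (4 * \<nu>)" "a \<le> \<beta> / 2"
      using pos \<beta> by (auto simp: a_def)
    have aD: "a * ((incr z)\<^sup>2 + (err z)\<^sup>2) \<le> D z" for z
      using mult_right_mono[OF a(2), of "(incr z)\<^sup>2"] mult_right_mono[OF a(3), of "(err z)\<^sup>2"]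
      by (simp add: D_def algebra_simps)
    \<comment> \<open>One factor \<open>(\<nu> * L + 1)\<^sup>2\<close> comes from bounding
      \<open>E\<close> by \<open>incr + err\<close>, the 2 from squaring that sum, and
      \<open>1 / a\<close> from the smaller weight in \<open>D\<close>.\<close>
    have E_le: "(E z)\<^sup>2 \<le> 2 * (\<nu> * L + 1)\<^sup>2 / a * D z" if z: "z \<in> \<U> \<times> \<P>" for z
    proof -
      let ?b = "\<nu> * L + 1"
      have b: "?b \<ge> 1"
        using pos by simp
      have nonneg: "0 \<le> incr z" "0 \<le> err z" "0 \<le> E z"
        by (auto simp: incr_def err_def E_def \<Lambda>_def)
      have "incr z \<le> ?b * incr z"
        using mult_right_mono[OF b nonneg(1)] by simp
      then have "E z \<le> ?b * (incr z + err z)"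
        using step[OF z] by (simp add: E_def algebra_simps)
      then have "(E z)\<^sup>2 \<le> (?b * (incr z + err z))\<^sup>2"
        using nonneg by (intro power_mono)
      also have "\<dots> = ?b\<^sup>2 * (incr z + err z)\<^sup>2"
        by (rule power_mult_distrib)
      also have "\<dots> \<le> ?b\<^sup>2 * (2 * ((incr z)\<^sup>2 + (err z)\<^sup>2))"
        using sum_squares_bound[of "incr z" "err z"]
        by (intro mult_left_mono zero_le_power2) (simp add: power2_sum)
      also have "\<dots> \<le> ?b\<^sup>2 * (2 * (D z / a))"
        using aD[of z] a(1) by (intro mult_left_mono) (auto simp: field_simps)
      finally show ?thesis
        by (simp add: field_simps)
    qed
    have D_nonneg: "0 \<le> D z" for z
      using pos \<beta> by (simp add: D_def)
    have \<Omega>: "\<Omega> \<subseteq> \<U> \<times> \<P>"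
      using Pstar ubar_minimizes(1) by (auto simp: \<Omega>_def)
    have inv: "F \<in> \<U> \<times> \<P> \<rightarrow> \<U> \<times> \<P>"
      using step by (auto simp: mem_Times_iff)
    have W: "continuous_on (\<U> \<times> \<P>) W"
      unfolding W_def by (intro continuous_intros cont_snd Js cont_err)
    have W0: "W z \<ge> 0" if "z \<in> \<U> \<times> \<P>" for z
      using that Js(2) \<beta> by (auto simp: W_def)
    have W1: "W z = 0 \<longleftrightarrow> z \<in> \<Omega>" if "z \<in> \<U> \<times> \<P>" for z
    proof -
      have "W z = 0 \<longleftrightarrow> Js (snd z) = 0 \<and> err z = 0"
        using that Js(2) \<beta> by (auto simp: W_def add_nonneg_eq_0_iff)
      then show ?thesis
        using that Js(3) by (cases z) (auto simp: \<Omega>_def err_def)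
    qed
    have E: "continuous_on (\<U> \<times> \<P>) E"
      unfolding E_def by (intro continuous_intros cont_snd \<Lambda> cont_err)
    have E0: "E z \<ge> 0" for z
      by (simp add: E_def \<Lambda>_def err_def)
    have E1: "z \<in> \<Omega>" if "z \<in> \<U> \<times> \<P>" "E z = 0" for z
    proof -
      have "\<Lambda> (snd z) = 0" "err z = 0"
        using that(2) by (auto simp: E_def \<Lambda>_def err_def add_nonneg_eq_0_iff)
      then show ?thesis
        using that(1) \<Lambda>(2) by (cases z) (auto simp: \<Omega>_def err_def)
    qed
    note stable = asymptotically_stable_Lyapunov[OF X inv \<Omega> W W0 W1 _ D_nonneg E E0 E1 E_le]
    have "(\<lambda>n. incr ((F ^^ n) z)) \<longlonglongrightarrow> 0" if z: "z \<in> \<U> \<times> \<P>" for z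
    proof -
      have "(\<lambda>n. D ((F ^^ n) z)) \<longlonglongrightarrow> 0"
        using stable(2) step z by blast
      then have "(\<lambda>n. sqrt (4 * \<nu> * D ((F ^^ n) z))) \<longlonglongrightarrow> 0"
        by (auto intro!: tendsto_eq_intros)
      then show ?thesis
      proof (rule Lim_null_comparison[rotated], intro always_eventually allI)
        fix n
        have "(incr ((F ^^ n) z))\<^sup>2 \<le> 4 * \<nu> * D ((F ^^ n) z)"
          using pos \<beta> by (simp add: D_def field_simps)
        then show "norm (incr ((F ^^ n) z)) \<le> sqrt (4 * \<nu> * D ((F ^^ n) z))"
          by (simp add: real_le_rsqrt)
      qed
    qed
    moreover have "asymptotically_stable F (\<U> \<times> \<P>) \<Omega>"
      using stable(1) step by blast
    ultimately show "let F = bilevel_step J U P \<mu> \<nu> \<kappa> in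
        asymptotically_stable F (\<U> \<times> \<P>) {(ubar p, p) | p. p \<in> Pstar} \<and>
        (\<forall>z\<in>\<U> \<times> \<P>. (\<lambda>l. norm (snd ((F ^^ Suc l) z) - snd ((F ^^ l) z))) \<longlonglongrightarrow> 0)"
      by (simp add: Let_def F_def \<Omega>_def incr_def)
  qed
qed

end


section \<open>The inner optimal control cost\<close>

lemma inner_symmetric_matrix: "transpose M = M \<Longrightarrow> x \<bullet> (M *v y) = y \<bullet> (M *v x)"
  for M :: "real^'n^'n"
  by (metis dot_lmul_matrix inner_commute transpose_matrix_vector)

lemma quadratic_form_line:
  fixes M :: "real^'n^'n"
  assumes "transpose M = M"
  shows "(x + t *\<^sub>R y) \<bullet> (M *v (x + t *\<^sub>R y)) =
    x \<bullet> (M *v x) + 2 * t * (y \<bullet> (M *v x)) + t\<^sup>2 * (y \<bullet> (M *v y))"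
  using inner_symmetric_matrix[OF assms, of x y]
  by (simp add: matrix_vector_right_distrib matrix_vector_mult_scaleR inner_add_left inner_add_right
      power2_eq_square algebra_simps)

text \<open>The state is affine in the inputs, and offset and initial state drop out of
  differences.\<close>

lemma state_line:
  "state A B e x0 \<sigma> (u + t *\<^sub>R h) k = state A B e x0 \<sigma> u k + t *\<^sub>R state A B 0 0 \<sigma> h k"
  by (induction k)
    (simp_all add: matrix_vector_right_distrib matrix_vector_mult_scaleR algebra_simps)

text \<open>The second-order term is the cost of \<open>h\<close> for the homogeneous dynamics started at \<open>0\<close>.\<close>

lemma inner_cost_line:
  assumes "transpose (Q p) = Q p" "transpose (R p) = R p" "transpose (S p) = S p"
  shows "\<exists>l. \<forall>t. inner_cost A B e Q R S x0 N \<sigma> (u + t *\<^sub>R h) p =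
    inner_cost A B e Q R S x0 N \<sigma> u p + t * l + t\<^sup>2 * inner_cost A B (\<lambda>_. 0) Q R S 0 N \<sigma> h p"
proof -
  define x where "x = state (A p) (B p) (e p) x0 \<sigma> u"
  define y where "y = state (A p) (B p) 0 0 \<sigma> h"
  define a where "a k = x k \<bullet> (Q p *v x k) + u $ \<sigma> k \<bullet> (R p *v u $ \<sigma> k)" for k
  define b where "b k = y k \<bullet> (Q p *v x k) + h $ \<sigma> k \<bullet> (R p *v u $ \<sigma> k)" for k
  define c where "c k = y k \<bullet> (Q p *v y k) + h $ \<sigma> k \<bullet> (R p *v h $ \<sigma> k)" for k
  have stage: "(x k + t *\<^sub>R y k) \<bullet> (Q p *v (x k + t *\<^sub>R y k))
      + (u + t *\<^sub>R h) $ \<sigma> k \<bullet> (R p *v (u + t *\<^sub>R h) $ \<sigma> k) = a k + 2 * t * b k + t\<^sup>2 * c k" for t k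
    unfolding vector_add_component vector_scaleR_component quadratic_form_line[OF assms(1)]
      quadratic_form_line[OF assms(2)] a_def b_def c_def by (simp add: ring_distribs)
  have "inner_cost A B e Q R S x0 N \<sigma> (u + t *\<^sub>R h) p =
      1 / 2 * (x N \<bullet> (S p *v x N)) + 1 / 2 * sum a {..<N}
        + t * (y N \<bullet> (S p *v x N) + sum b {..<N})
        + t\<^sup>2 * (1 / 2 * (y N \<bullet> (S p *v y N)) + 1 / 2 * sum c {..<N})" for t
    unfolding inner_cost_def Let_def state_line x_def[symmetric] y_def[symmetric] stage
      quadratic_form_line[OF assms(3)]
    unfolding sum.distrib sum_distrib_left[symmetric]
    by (simp add: ring_distribs)
  then show ?thesis
    by (intro exI[of _ "y N \<bullet> (S p *v x N) + sum b {..<N}"])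
      (simp add: inner_cost_def Let_def x_def y_def a_def c_def)
qed

text \<open>The linear coefficient along one direction must be the derivative at 0. This gives the
  exact second-order expansion of the cost without assembling its Hessian.\<close>

lemma quadratic_along_lines_expansion:
  assumes "\<And>t. f (u + t *\<^sub>R h) = f u + t * l + t\<^sup>2 * q" and "GDERIV f u :> g"
  shows "f (u + h) = f u + h \<bullet> g + q"
proof -
  have "((\<lambda>t. f (u + t *\<^sub>R h)) has_real_derivative h \<bullet> g) (at 0)"
    using assms(2) by (auto intro: GDERIV_along_line)
  moreover have "((\<lambda>t. f (u + t *\<^sub>R h)) has_real_derivative l) (at 0)"
    unfolding assms(1) by (auto intro!: derivative_eq_intros)
  ultimately have "h \<bullet> g = l"
    by (rule DERIV_unique)
  then show ?thesis
    using assms(1)[of 1] by simp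
qed

text \<open>The form is continuous and positive on the compact product of \<open>C\<close> and the
  unit sphere; its minimum there extends to all \<open>v\<close> by homogeneity.\<close>

lemma uniformly_pos_def:
  fixes R :: "'p::metric_space \<Rightarrow> real^'m^'m"
  assumes C: "compact C" and R: "continuous_on C R" "\<And>p. p \<in> C \<Longrightarrow> sym_pos_def (R p)"
  obtains r where "r > 0" "\<And>p v. p \<in> C \<Longrightarrow> r * (norm v)\<^sup>2 \<le> v \<bullet> (R p *v v)"
proof -
  let ?K = "C \<times> sphere (0 :: real^'m) 1"
  let ?f = "\<lambda>z. snd z \<bullet> (R (fst z) *v snd z)"
  interpret mv: bounded_bilinear "(*v) :: real^'m^'m \<Rightarrow> real^'m \<Rightarrow> real^'m"
    by (rule bounded_bilinear_matrix_vector_mult)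
  have "continuous_on ?K (\<lambda>z. R (fst z))"
    by (rule continuous_on_compose2[OF R(1) continuous_on_fst[OF continuous_on_id]]) auto
  then have cont: "continuous_on ?K ?f"
    by (intro continuous_intros mv.continuous_on)
  have "compact ?K"
    using C by (simp add: compact_Times)
  have "\<exists>r>0. \<forall>z\<in>?K. r \<le> ?f z"
  proof (cases "?K = {}")
    case False
    from continuous_attains_inf[OF \<open>compact ?K\<close> this cont]
    obtain z where z: "z \<in> ?K" "\<forall>w\<in>?K. ?f z \<le> ?f w"
      by blast
    moreover have "snd z \<noteq> 0"
      using z(1) by auto
    ultimately have "?f z > 0"
      using R(2)[of "fst z"] by (auto simp: sym_pos_def_def)
    then show ?thesis
      using z by blast
  qed (auto intro: exI[of _ 1])
  then obtain r where r: "r > 0" "\<And>p v. p \<in> C \<Longrightarrow> norm v = 1 \<Longrightarrow> r \<le> v \<bullet> (R p *v v)"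
    by force
  show ?thesis
  proof
    show "r * (norm v)\<^sup>2 \<le> v \<bullet> (R p *v v)" if p: "p \<in> C" for p v
    proof (cases "v = 0")
      case False
      let ?w = "v /\<^sub>R norm v"
      have v: "v = norm v *\<^sub>R ?w"
        using False by simp
      have "v \<bullet> (R p *v v) = (norm v)\<^sup>2 * (?w \<bullet> (R p *v ?w))"
        by (subst (1 2) v) (simp only: matrix_vector_mult_scaleR inner_scaleR_left
            inner_scaleR_right power2_eq_square mult_ac)
      then show ?thesis
        using r(2)[OF p, of ?w] False by (simp add: mult.commute mult_left_mono)
    qed simp
  qed (rule r(1))
qed

text \<open>The \<open>Q\<close> and \<open>S\<close> terms are dropped as nonnegative. Because
  \<open>\<sigma>\<close> hits every stage exactly once, the input terms add up to the full norm of
  \<open>h\<close>.\<close>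

lemma inner_cost_homogeneous_ge:
  fixes \<sigma> :: "nat \<Rightarrow> 'h::finite"
  assumes \<sigma>: "bij_betw \<sigma> {..<N} UNIV" and QS: "sym_pos_semidef (Q p)" "sym_pos_semidef (S p)"
    and R: "\<And>v. r * (norm v)\<^sup>2 \<le> v \<bullet> (R p *v v)"
  shows "r / 2 * (norm h)\<^sup>2 \<le> inner_cost A B e Q R S x0 N \<sigma> h p"
proof -
  have "(norm h)\<^sup>2 = (\<Sum>i\<in>UNIV. (norm (h $ i))\<^sup>2)"
    by (simp add: power2_norm_eq_inner inner_vec_def)
  also have "\<dots> = (\<Sum>k<N. (norm (h $ \<sigma> k))\<^sup>2)"
    by (rule sum.reindex_bij_betw[OF \<sigma>, symmetric])
  finally have "r * (norm h)\<^sup>2 = (\<Sum>k<N. r * (norm (h $ \<sigma> k))\<^sup>2)"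
    by (simp add: sum_distrib_left)
  also have "\<dots> \<le> (\<Sum>k<N. state (A p) (B p) (e p) x0 \<sigma> h k \<bullet> (Q p *v state (A p) (B p) (e p) x0 \<sigma> h k)
      + h $ \<sigma> k \<bullet> (R p *v h $ \<sigma> k))"
    using QS(1) by (intro sum_mono) (simp add: sym_pos_semidef_def R add_increasing)
  finally show ?thesis
    using QS(2) by (simp add: inner_cost_def Let_def sym_pos_semidef_def add_increasing)
qed

section \<open>Joint regularity of the cost in inputs and parameter\<close>

context
  fixes A :: "'p::euclidean_space \<Rightarrow> real^'n^'n" and B :: "'p \<Rightarrow> real^'m^'n" and e :: "'p \<Rightarrow> real^'n"
    and Q S :: "'p \<Rightarrow> real^'n^'n" and R :: "'p \<Rightarrow> real^'m^'m" and j :: nat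
  assumes Ck: "Ck j A" "Ck j B" "Ck j e" "Ck j Q" "Ck j R" "Ck j S"
begin

lemma Ck_state:
  "Ck j (\<lambda>z::(real^'m^'h::finite) \<times> 'p. state (A (snd z)) (B (snd z)) (e (snd z)) x0 \<sigma> (fst z) k)"
proof (induction k)
  case (Suc k)
  have "bounded_linear (\<lambda>z::(real^'m^'h) \<times> 'p. fst z $ \<sigma> k)"
    by (rule bounded_linear_compose[OF bounded_linear_vec_nth bounded_linear_fst])
  then show ?case
    using Suc
    by (auto intro!: Ck_add bounded_bilinear.Ck_prod[OF bounded_bilinear_matrix_vector_mult]
        Ck_compose_linear[OF bounded_linear_snd] Ck Ck_linear[OF \<open>bounded_linear _\<close>])
qed (simp add: Ck_const)

text \<open>The cost is polynomial in the inputs and the entries of the data. Regularity is stated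
  for the pair because the Lipschitz bound on the p-gradient must cover changes in both
  arguments.\<close>

lemma Ck_inner_cost:
  fixes \<sigma> :: "nat \<Rightarrow> 'h::finite"
  shows "Ck j (\<lambda>z. inner_cost A B e Q R S x0 N \<sigma> (fst z) (snd z))"
proof -
  have u: "bounded_linear (\<lambda>z::(real^'m^'h) \<times> 'p. fst z $ i)" for i
    by (rule bounded_linear_compose[OF bounded_linear_vec_nth bounded_linear_fst])
  show ?thesis
    unfolding inner_cost_def Let_def
    by (intro Ck_add Ck_sum bounded_bilinear.Ck_prod[OF bounded_bilinear_mult] Ck_const
        bounded_bilinear.Ck_prod[OF bounded_bilinear_inner] Ck_state Ck_linear[OF u]
        bounded_bilinear.Ck_prod[OF bounded_bilinear_matrix_vector_mult]
        Ck_compose_linear[OF bounded_linear_snd] Ck)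
qed

end

text \<open>Both gradients are read off the joint derivative along one factor. Class 2 leaves the
  p-gradient in class 1, hence Lipschitz on \<open>D\<close>.\<close>

lemma partial_gradients:
  fixes J :: "'u::euclidean_space \<Rightarrow> 'p::euclidean_space \<Rightarrow> real"
  assumes J: "Ck 2 (\<lambda>z. J (fst z) (snd z))" and D: "compact D" "convex D"
  obtains Gu Gp L where "\<And>u p. GDERIV (\<lambda>u. J u p) u :> Gu u p" "\<And>u p. GDERIV (J u) p :> Gp u p"
    "L-lipschitz_on D (\<lambda>z. Gp (fst z) (snd z))"
proof -
  let ?J = "\<lambda>z. J (fst z) (snd z)"
  let ?J' = "\<lambda>z. frechet_derivative ?J (at z)"
  have J2: "Ck (Suc 1) ?J"
    using J by (simp add: numeral_2_eq_2)
  define Gu where "Gu u p = (\<Sum>b\<in>Basis. ?J' (u, p) (b, 0) *\<^sub>R b)" for u p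
  define Gp where "Gp u p = (\<Sum>b\<in>Basis. ?J' (u, p) (0, b) *\<^sub>R b)" for u p
  have "GDERIV (\<lambda>u. J u p) u :> Gu u p" for u p
  proof -
    have "((\<lambda>u. (u, p)) has_derivative (\<lambda>h. (h, 0))) (at u)"
      by (auto intro!: derivative_eq_intros)
    from has_derivative_compose[OF this Ck_Suc_has_derivative[OF J2]]
    show ?thesis
      unfolding Gu_def by (intro has_derivative_imp_GDERIV) simp
  qed
  moreover have "GDERIV (J u) p :> Gp u p" for u p
  proof -
    have "((\<lambda>p. (u, p)) has_derivative (\<lambda>h. (0, h))) (at p)"
      by (auto intro!: derivative_eq_intros)
    from has_derivative_compose[OF this Ck_Suc_has_derivative[OF J2]]
    show ?thesis
      unfolding Gp_def by (intro has_derivative_imp_GDERIV) simp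
  qed
  moreover have "Ck 1 (\<lambda>z. Gp (fst z) (snd z))"
  proof -
    have "Ck 1 (\<lambda>z. ?J' z (0, b))" for b
      using J2 by simp
    then show ?thesis
      unfolding Gp_def prod.collapse
      by (intro Ck_sum bounded_bilinear.Ck_prod[OF bounded_bilinear_scaleR] Ck_const)
  qed
  from Ck_1_lipschitz_on[OF this D] obtain L where "L-lipschitz_on D (\<lambda>z. Gp (fst z) (snd z))" .
  ultimately show ?thesis ..
qed

theorem proposition2:
  fixes A :: "real^'l \<Rightarrow> real^'n^'n"
    and B :: "real^'l \<Rightarrow> real^'m^'n"
    and e :: "real^'l \<Rightarrow> real^'n"
    and Q S :: "real^'l \<Rightarrow> real^'n^'n"
    and R :: "real^'l \<Rightarrow> real^'m^'m"
    and x0 :: "real^'n"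
    and N :: nat
    and \<sigma> :: "nat \<Rightarrow> 'h::finite"
    and U :: "real^'m^'h \<Rightarrow> ereal"
    and P :: "real^'l \<Rightarrow> ereal"
    and \<mu> \<nu> :: real
    and J :: "real^'m^'h \<Rightarrow> real^'l \<Rightarrow> real"
    and ubar :: "real^'l \<Rightarrow> real^'m^'h"
    and Jbar :: "real^'l \<Rightarrow> real"
    and \<U> :: "(real^'m^'h) set"
    and \<P> Pstar :: "(real^'l) set"
  assumes stages: "bij_betw \<sigma> {..<N} UNIV"
    and smooth_dynamics: "smooth A" "smooth B" "smooth e"
    and smooth_weights: "smooth Q" "smooth R" "smooth S"
    and definite: "\<And>p. sym_pos_def (R p)" "\<And>p. sym_pos_semidef (Q p)" "\<And>p. sym_pos_semidef (S p)"
    and U: "proper U" "convex_ereal U" "lower_semicontinuous U" "compact (effective_domain U)"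
    and P: "proper P" "convex_ereal P" "lower_semicontinuous P" "compact (effective_domain P)"
    and \<U>_def: "\<U> = effective_domain U"
    and \<P>_def: "\<P> = effective_domain P"
    and J_def: "J = inner_cost A B e Q R S x0 N \<sigma>"
    and ubar_def: "ubar = inner_minimizer J U"
    and Jbar_def: "Jbar = inner_value J U"
    and Pstar_def: "Pstar = {p. is_arg_min (\<lambda>q. ereal (Jbar q) + P q) (\<lambda>_. True) p}"
    and steps_pos: "\<mu> > 0" "\<nu> > 0"
    and step_length_\<nu>: "(1 / \<nu>)-lipschitz_on \<P> (gradient Jbar)"
    and step_length_\<mu>: "\<And>p. p \<in> \<P> \<Longrightarrow> (1 / \<mu>)-lipschitz_on UNIV (gradient (\<lambda>u. J u p))"
    and size_J: "size_function_ereal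
      (\<lambda>p. ereal (Jbar p) + P p - (INF q. ereal (Jbar q) + P q)) \<P> Pstar"
    and size_\<Lambda>: "size_function
      (\<lambda>p. norm (prox (\<lambda>q. ereal \<nu> * P q) (p - \<nu> *\<^sub>R gradient Jbar p) - p)) Pstar"
  shows "\<exists>K. \<forall>\<kappa>\<ge>K. \<kappa> \<ge> 1 \<longrightarrow>
      asymptotically_stable (bilevel_step J U P \<mu> \<nu> \<kappa>) (\<U> \<times> \<P>) {(ubar p, p) | p. p \<in> Pstar} \<and>
      (\<forall>z \<in> \<U> \<times> \<P>.
        (\<lambda>l. norm (snd ((bilevel_step J U P \<mu> \<nu> \<kappa> ^^ Suc l) z)
                   - snd ((bilevel_step J U P \<mu> \<nu> \<kappa> ^^ l) z))) \<longlonglongrightarrow> 0)"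
proof -
  define rU where "rU u = real_of_ereal (U u)" for u
  define rP where "rP p = real_of_ereal (P p)" for p
  have penU: "penalty_on U \<U> rU"
    using penalty_onI[OF U] by (simp add: \<U>_def rU_def[abs_def])
  have penP: "penalty_on P \<P> rP"
    using penalty_onI[OF P] by (simp add: \<P>_def rP_def[abs_def])
  \<comment> \<open>The open ball will be the neighbourhood \<open>C\<close>; its closure is compact
    and provides the modulus \<open>r\<close> and the constant \<open>L\<close>.\<close>
  obtain \<rho> where \<rho>: "\<P> \<subseteq> ball 0 \<rho>"
    using bounded_subset_ballD[OF compact_imp_bounded[OF P(4)], of 0] by (auto simp: \<P>_def)
  have "continuous_on (cball 0 \<rho>) R"
  proof -
    have "Ck 0 R"
      using smooth_weights(2) unfolding smooth_def by blast
    then show ?thesis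
      using continuous_on_subset by auto
  qed
  then obtain r where r: "r > 0" "\<And>p v. p \<in> cball 0 \<rho> \<Longrightarrow> r * (norm v)\<^sup>2 \<le> v \<bullet> (R p *v v)"
    using uniformly_pos_def[of "cball 0 \<rho>" R] definite(1) compact_cball by blast
  have "Ck 2 (\<lambda>z. J (fst z) (snd z))"
    unfolding J_def using smooth_dynamics smooth_weights
    by (intro Ck_inner_cost) (auto simp: smooth_def)
  moreover have "compact (\<U> \<times> cball (0 :: real^'l) \<rho>)" "convex (\<U> \<times> cball (0 :: real^'l) \<rho>)"
    using penU convex_on_imp_convex
    by (auto simp: penalty_on_def intro!: compact_Times convex_Times)
  ultimately obtain Gu Gp L where G: "\<And>u p. GDERIV (\<lambda>u. J u p) u :> Gu u p"
      "\<And>u p. GDERIV (J u) p :> Gp u p"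
      "L-lipschitz_on (\<U> \<times> cball 0 \<rho>) (\<lambda>z. Gp (fst z) (snd z))"
    by (rule partial_gradients) blast
  \<comment> \<open>\<open>L + 1\<close> replaces \<open>L\<close> because the locale asks for a
    strictly positive constant.\<close>
  interpret bilevel_problem J Gu Gp U \<U> rU P \<P> rP "ball 0 \<rho>" r "L + 1" \<mu> \<nu>
  proof
    fix u v p assume p: "p \<in> ball (0 :: real^'l) \<rho>"
    let ?q = "inner_cost A B (\<lambda>_. 0) Q R S 0 N \<sigma> (v - u) p"
    obtain l where "\<And>t. J (u + t *\<^sub>R (v - u)) p = J u p + t * l + t\<^sup>2 * ?q"
      using inner_cost_line[of Q p R S A B e x0 N \<sigma> u "v - u"] definite
      by (auto simp: J_def sym_pos_def_def sym_pos_semidef_def)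
    from quadratic_along_lines_expansion[where f = "\<lambda>u. J u p", OF this G(1)]
    have "J v p = J u p + (v - u) \<bullet> Gu u p + ?q"
      by simp
    moreover have "r / 2 * (norm (v - u))\<^sup>2 \<le> ?q"
      using p by (intro inner_cost_homogeneous_ge stages definite r(2)) auto
    ultimately show "J u p + (v - u) \<bullet> Gu u p + r / 2 * (norm (v - u))\<^sup>2 \<le> J v p"
      by simp
  next
    fix u v and p q :: "real^'l"
    assume *: "u \<in> \<U>" "v \<in> \<U>" "p \<in> ball 0 \<rho>" "q \<in> ball 0 \<rho>"
    have "norm (Gp u p - Gp v q) \<le> L * norm ((u, p) - (v, q))"
      using lipschitz_on_normD[OF G(3), of "(u, p)" "(v, q)"] * by auto
    also have "\<dots> \<le> (L + 1) * (norm (u - v) + norm (p - q))"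
      using norm_Pair_le[of "u - v" "p - q"] lipschitz_on_nonneg[OF G(3)]
      by (intro mult_mono) auto
    finally show "norm (Gp u p - Gp v q) \<le> (L + 1) * (norm (u - v) + norm (p - q))" .
  next
    fix p assume "p \<in> \<P>"
    have "gradient (\<lambda>u. J u p) = (\<lambda>u. Gu u p)"
      using gradient_eqI[OF G(1)] by blast
    then show "(1 / \<mu>)-lipschitz_on UNIV (\<lambda>u. Gu u p)"
      using step_length_\<mu>[OF \<open>p \<in> \<P>\<close>] by simp
  qed (use penU penP \<rho> r(1) steps_pos lipschitz_on_nonneg[OF G(3)] step_length_\<nu> G
      in \<open>auto simp: Jbar_def\<close>)
  define \<omega> where "\<omega> p = ereal (Jbar p) + P p - (INF q. ereal (Jbar q) + P q)" for p
  have \<omega>: "\<And>p. p \<in> \<P> \<Longrightarrow> \<bar>\<omega> p\<bar> \<noteq> \<infinity>" "continuous_on \<P> \<omega>" "\<And>p. p \<notin> \<P> \<Longrightarrow> \<omega> p = \<infinity>"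
      "\<And>p. \<omega> p \<ge> 0" "\<And>p. \<omega> p = 0 \<longleftrightarrow> p \<in> Pstar"
    using size_J by (auto simp: size_function_ereal_def \<omega>_def[abs_def])
  have P_eq: "P p = ereal (rP p)" if "p \<in> \<P>" for p
    using penP that by (simp add: penalty_on_def)
  obtain p0 where p0: "p0 \<in> \<P>"
    using penP by (auto simp: penalty_on_def)
  \<comment> \<open>An infinite infimum would make \<open>\<omega>\<close> infinite at
    \<open>p0\<close>, against the size-function assumption.\<close>
  obtain c where "(INF q. ereal (Jbar q) + P q) = ereal c"
    using \<omega>(1)[OF p0] P_eq[OF p0] by (cases "INF q. ereal (Jbar q) + P q") (auto simp: \<omega>_def)
  then have \<omega>_eq: "\<omega> p = ereal (Jbar p + rP p - c)" if "p \<in> \<P>" for p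
    using that by (simp add: \<omega>_def P_eq)
  have Pstar: "Pstar \<subseteq> \<P>"
    using \<omega>(3,5) by force
  have Js: "continuous_on \<P> (\<lambda>p. Jbar p + rP p - c)"
    using iffD1[OF continuous_on_cong[OF refl \<omega>_eq] \<omega>(2)]
    unfolding continuous_on_def lim_ereal .
  have \<Lambda>: "continuous_on \<P> (\<lambda>p. norm (prox (\<lambda>q. ereal \<nu> * P q) (p - \<nu> *\<^sub>R gradient Jbar p) - p))"
      "norm (prox (\<lambda>q. ereal \<nu> * P q) (p - \<nu> *\<^sub>R gradient Jbar p) - p) = 0 \<Longrightarrow> p \<in> Pstar" for p
    using size_\<Lambda> continuous_on_subset unfolding size_function_def by blast+
  have "\<exists>K. \<forall>\<kappa>\<ge>K. let F = bilevel_step J U P \<mu> \<nu> \<kappa> in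
    asymptotically_stable F (\<U> \<times> \<P>) {(inner_minimizer J U p, p) | p. p \<in> Pstar} \<and>
    (\<forall>z\<in>\<U> \<times> \<P>. (\<lambda>l. norm (snd ((F ^^ Suc l) z) - snd ((F ^^ l) z))) \<longlonglongrightarrow> 0)"
  proof (rule bilevel_iteration_stable[OF Js _ _ _ Pstar])
    show "0 \<le> Jbar p + rP p - c" if "p \<in> \<P>" for p
      using \<omega>(4)[of p] \<omega>_eq[OF that] by simp
    show "Jbar p + rP p - c = 0 \<longleftrightarrow> p \<in> Pstar" if "p \<in> \<P>" for p
      using \<omega>(5)[of p] \<omega>_eq[OF that] by simp
  qed (use \<Lambda> in \<open>auto simp: Jbar_def\<close>)
  then show ?thesis
    unfolding ubar_def Let_def by blast
qed

end
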